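(* For every $\alpha\in(0,1)$, the graphon $W^c_\alpha$ (which is weakly isomorphic to the graphon $W_{\mu^m_\alpha}$ associated with the permuton $\mu^m_\alpha$) is not finitely forcible.
   Context: A graphon is a symmetric measurable function $W:[0,1]^2\to[0,1]$. A $W$-random graph of order $k$ is obtained by sampling $x_1,\dots,x_k\in[0,1]$ uniformly and independently and joining vertices $i$ and $j$ by an edge with probability $W(x_i,x_j)$, independently. For a graph $H$, $d(H,W)$ is the probability that a $W$-random graph of order $|H|$ is isomorphic to $H$. Graphons $W,W'$ are weakly isomorphic if $d(H,W)=d(H,W')$ for every graph $H$. A graphon $W$ is finitely forcible if there are graphs $H_1,\dots,H_k$ such that every graphon $W'$ with $d(H_i,W')=d(H_i,W)$ for all $i\in[k]$ is weakly isomorphic to $W$. For $\alpha\in(0,1)$ let $a_i=(1-\alpha)\alpha^{i-1}$, $i\ge1$; $W^c_\alpha(x,y)=1$ if there is $j\ge1$ with $\sum_{i=1}^{j-1}a_i\le x,y\le\sum_{i=1}^{j}a_i$, and $W^c_\alpha(x,y)=0$ otherwise. The permuton $\mu^m_\alpha$ is $\sum_{i\ge1}(1-\alpha)\alpha^{i-1}\lambda_{I(1-\alpha^{i-1},1-\alpha^i)}$ where $I(z,z')=\{(x,z'+z-x):x\in[z,z']\}$ and $\lambda_I$ is the uniform probability measure on the segment $I$. For a permuton $\mu$ (a probability measure on $[0,1]^2$ with uniform marginals), the associated graphon $W_\mu$ is a graphon (unique up to weak isomorphism) such that for every $n$, the $W_\mu$-random graph of order $n$ has the same distribution up to isomorphism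 as the inversion graph of a $\mu$-random permutation of order $n$; here the inversion graph $G_\pi$ of a permutation $\pi$ of $[k]$ has vertex set $[k]$ and $ij$, $i<j$, is an edge iff $\pi(i)>\pi(j)$, and a $\mu$-random permutation is obtained by sampling $n$ points according to $\mu$, ordering them by $x$-coordinate and recording the relative order of their $y$-coordinates. *)

theory Defs
  imports "HOL-Probability.Probability"
begin

section \<open>Finite simple graphs\<close>

record 'a ugraph =
  verts :: "'a set"
  edges :: "'a set set"

definition finite_simple_graph :: "'a ugraph \<Rightarrow> bool" where
  "finite_simple_graph G \<longleftrightarrow>
     finite (verts G) \<and> (\<forall>e\<in>edges G. e \<subseteq> verts G \<and> card e = 2)"

definition graph_iso :: "'a ugraph \<Rightarrow> 'b ugraph \<Rightarrow> bool"  (infix "\<cong>\<^sub>g" 50) where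
  "G \<cong>\<^sub>g H \<longleftrightarrow>
     (\<exists>f. bij_betw f (verts G) (verts H) \<and>
          (\<forall>u\<in>verts G. \<forall>v\<in>verts G. {u, v} \<in> edges G \<longleftrightarrow> {f u, f v} \<in> edges H))"


section \<open>Graphons and random graphs\<close>

text \<open>Restricting (rather than conditioning) Lebesgue measure makes the sample space exactly
  the unit interval, so the values of a graphon outside the unit square play no role.\<close>

definition unif01 :: "real measure" where
  "unif01 = restrict_space lborel {0..1}"

definition graphon :: "(real \<Rightarrow> real \<Rightarrow> real) \<Rightarrow> bool" where
  "graphon W \<longleftrightarrow>
     case_prod W \<in> borel_measurable (unif01 \<Otimes>\<^sub>M unif01) \<and>
     (\<forall>x\<in>{0..1}. \<forall>y\<in>{0..1}. W x y = W y x \<and> W x y \<in> {0..1})"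

text \<open>The random graph on the vertices \<open>0, \<dots>, k - 1\<close> for already sampled points \<open>x\<close>;
  the coins \<open>c\<close> are indexed by the pairs \<open>i < j\<close>.\<close>

definition edge_sampling_pmf ::
    "nat \<Rightarrow> (real \<Rightarrow> real \<Rightarrow> real) \<Rightarrow> (nat \<Rightarrow> real) \<Rightarrow> nat ugraph pmf" where
  "edge_sampling_pmf k W x =
     map_pmf (\<lambda>c. \<lparr>verts = {..<k}, edges = {{i, j} |i j. i < j \<and> j < k \<and> c (i, j)}\<rparr>)
       (Pi_pmf {(i, j). i < j \<and> j < k} False (\<lambda>(i, j). bernoulli_pmf (W (x i) (x j))))"

definition W_random_graph :: "nat \<Rightarrow> (real \<Rightarrow> real \<Rightarrow> real) \<Rightarrow> nat ugraph measure" where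
  "W_random_graph k W =
     (\<Pi>\<^sub>M i\<in>{..<k}. unif01) \<bind> (\<lambda>x. measure_pmf (edge_sampling_pmf k W x))"

definition density_of :: "nat ugraph \<Rightarrow> (real \<Rightarrow> real \<Rightarrow> real) \<Rightarrow> real" where
  "density_of H W = measure (W_random_graph (card (verts H)) W) {G. G \<cong>\<^sub>g H}"

text \<open>Every finite graph has an isomorphic copy with vertices in \<^typ>\<open>nat\<close>, so quantifying
  over \<^typ>\<open>nat ugraph\<close> covers all finite graphs.\<close>

definition weakly_isomorphic ::
    "(real \<Rightarrow> real \<Rightarrow> real) \<Rightarrow> (real \<Rightarrow> real \<Rightarrow> real) \<Rightarrow> bool" where
  "weakly_isomorphic W W' \<longleftrightarrow>
     (\<forall>H :: nat ugraph. finite_simple_graph H \<longrightarrow> density_of H W = density_of H W')"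

definition finitely_forcible :: "(real \<Rightarrow> real \<Rightarrow> real) \<Rightarrow> bool" where
  "finitely_forcible W \<longleftrightarrow>
     (\<exists>\<H> :: nat ugraph set. finite \<H> \<and> (\<forall>H\<in>\<H>. finite_simple_graph H) \<and>
        (\<forall>W'. graphon W' \<and> (\<forall>H\<in>\<H>. density_of H W' = density_of H W)
              \<longrightarrow> weakly_isomorphic W' W))"


section \<open>The clique graphon with geometric part sizes\<close>

definition part_size :: "real \<Rightarrow> nat \<Rightarrow> real" where
  "part_size \<alpha> i = (1 - \<alpha>) * \<alpha> ^ (i - 1)"

definition clique_graphon :: "real \<Rightarrow> real \<Rightarrow> real \<Rightarrow> real" where
  "clique_graphon \<alpha> x y =
     (if \<exists>j\<ge>1. x \<in> {(\<Sum>i=1..j-1. part_size \<alpha> i) .. (\<Sum>i=1..j. part_size \<alpha> i)} \<and>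
                y \<in> {(\<Sum>i=1..j-1. part_size \<alpha> i) .. (\<Sum>i=1..j. part_size \<alpha> i)}
      then 1 else 0)"


section \<open>Permutons and their graphons\<close>

definition permuton :: "(real \<times> real) measure \<Rightarrow> bool" where
  "permuton \<mu> \<longleftrightarrow>
     prob_space \<mu> \<and> sets \<mu> = sets (unif01 \<Otimes>\<^sub>M unif01) \<and>
     distr \<mu> unif01 fst = unif01 \<and> distr \<mu> unif01 snd = unif01"

text \<open>\<open>antidiagonal_segment z z'\<close> is the segment from \<open>(z, z')\<close> to \<open>(z', z)\<close>.  The uniform
  measure on a segment is the image of the uniform measure on the unit interval under its
  constant-speed parametrisation.\<close>

definition antidiagonal_segment :: "real \<Rightarrow> real \<Rightarrow> (real \<times> real) set" where
  "antidiagonal_segment z z' = {(x, z' + z - x) |x. x \<in> {z..z'}}"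

definition uniform_antidiagonal :: "real \<Rightarrow> real \<Rightarrow> (real \<times> real) measure" where
  "uniform_antidiagonal z z' = distr unif01 (unif01 \<Otimes>\<^sub>M unif01) (linepath (z, z') (z', z))"

lemma antidiagonal_segment_eq_path_image:
  assumes "z \<le> z'"
  shows "antidiagonal_segment z z' = path_image (linepath (z, z') (z', z))"
proof -
  have "(x, z' + z - x) \<in> closed_segment (z, z') (z', z)" if "z \<le> x" "x \<le> z'" for x
  proof (cases "z = z'")
    case True
    then show ?thesis using that by auto
  next
    case False
    define u where "u = (x - z) / (z' - z)"
    have u: "u * (z' - z) = x - z" "0 \<le> u" "u \<le> 1"
      using False that assms by (auto simp: u_def)
    have "(x, z' + z - x) = (1 - u) *\<^sub>R (z, z') + u *\<^sub>R (z', z)"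
      using u(1) by (simp add: algebra_simps)
    then show ?thesis using u(2,3) unfolding in_segment by blast
  qed
  moreover have "p \<in> antidiagonal_segment z z'"
    if p: "p \<in> closed_segment (z, z') (z', z)" for p
  proof -
    from p obtain u where u: "0 \<le> u" "u \<le> 1" "p = (1 - u) *\<^sub>R (z, z') + u *\<^sub>R (z', z)"
      unfolding in_segment by auto
    have "0 \<le> u * (z' - z)" "0 \<le> (1 - u) * (z' - z)" using u assms by auto
    then show ?thesis using u(3) unfolding antidiagonal_segment_def
      by (intro CollectI exI[of _ "z + u * (z' - z)"]) (auto simp: algebra_simps)
  qed
  ultimately show ?thesis by (auto simp: antidiagonal_segment_def)
qed

text \<open>The weighted sum of measures, with the summation index starting at 0 instead of 1.\<close>

definition geometric_permuton :: "real \<Rightarrow> (real \<times> real) measure" where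
  "geometric_permuton \<alpha> =
     measure_of ({0..1} \<times> {0..1}) (sets (unif01 \<Otimes>\<^sub>M unif01))
       (\<lambda>A. \<Sum>i. ennreal ((1 - \<alpha>) * \<alpha> ^ i) *
                 emeasure (uniform_antidiagonal (1 - \<alpha> ^ i) (1 - \<alpha> ^ Suc i)) A)"

text \<open>The position of \<open>f i\<close> in increasing order among \<open>f 0, \<dots>, f (n - 1)\<close>.  Ties have
  probability zero in what follows; breaking them by index makes \<open>rank_of n f\<close> always
  a permutation of \<open>{..<n}\<close>.\<close>

definition rank_of :: "nat \<Rightarrow> (nat \<Rightarrow> real) \<Rightarrow> nat \<Rightarrow> nat" where
  "rank_of n f i = card {j. j < n \<and> (f j < f i \<or> f j = f i \<and> j < i)}"

text \<open>The permutation that sends the \<open>x\<close>-rank of each of the \<open>n\<close> points to its \<open>y\<close>-rank,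
  extended by the identity outside \<open>{..<n}\<close>.\<close>

definition perm_of_points :: "nat \<Rightarrow> (nat \<Rightarrow> real \<times> real) \<Rightarrow> nat \<Rightarrow> nat" where
  "perm_of_points n p r =
     (if r < n
      then rank_of n (\<lambda>i. snd (p i)) (THE i. i < n \<and> rank_of n (\<lambda>i. fst (p i)) i = r)
      else r)"

definition random_perm :: "nat \<Rightarrow> (real \<times> real) measure \<Rightarrow> (nat \<Rightarrow> nat) measure" where
  "random_perm n \<mu> = distr (\<Pi>\<^sub>M i\<in>{..<n}. \<mu>) (count_space UNIV) (perm_of_points n)"

definition inversion_graph :: "nat \<Rightarrow> (nat \<Rightarrow> nat) \<Rightarrow> nat ugraph" where
  "inversion_graph n \<pi> = \<lparr>verts = {..<n}, edges = {{i, j} |i j. i < j \<and> j < n \<and> \<pi> i > \<pi> j}\<rparr>"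

definition associated_graphon ::
    "(real \<times> real) measure \<Rightarrow> (real \<Rightarrow> real \<Rightarrow> real) \<Rightarrow> bool" where
  "associated_graphon \<mu> W \<longleftrightarrow>
     graphon W \<and>
     (\<forall>n. \<forall>H :: nat ugraph. finite_simple_graph H \<longrightarrow>
        measure (W_random_graph n W) {G. G \<cong>\<^sub>g H} =
        measure (distr (random_perm n \<mu>) (count_space UNIV) (inversion_graph n)) {G. G \<cong>\<^sub>g H})"

end

(* A graphon made of disjoint cliques of sizes b_i samples colours independently with law (b_i) and
   joins equal colours, so the density of a graph on n vertices depends only on the power sums
   sum_i b_i^k with 1 <= k <= n, and the density of the complete graph K_n is the n-th of them.
   Finitely many densities are therefore controlled by the power sums below some N.  For the
   geometric sizes, lowering the leading coefficient of prod_{i<N} (1 - b_i t) slightly keeps N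
   distinct positive roots; their reciprocals, which replace the N largest parts, have the same
   power sums below N by Newton's identities, but a different N-th one, so K_N tells the two
   graphons apart.

   The permuton is the law of (x, y), x uniform and y the mirror image of x in its part.  Two such
   points form an inversion iff they lie in the same part, so its inversion graphs are the random
   graphs of the clique graphon. *)

theory Submission
  imports Defs "HOL-Computational_Algebra.Polynomial_FPS"
begin

section \<open>Perturbing roots without changing power sums\<close>

text \<open>Densities see only power sums because of a factorisation: asking a colouring to be
  constant on each class of a given partition, while distinct classes may share a colour, is an
  intersection of independent events, each with a power sum as its probability. Asking for exactly
  this partition is not of that form, so the law of the colour pattern is recovered from the coarser
  events by Moebius inversion. Prescribing the power sums below N of N numbers fixes all their
  elementary symmetric functions except the last one, up to sign the leading coefficient; this is
  the only parameter left to vary. Simple real roots survive a small change of it, and the strict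
  decrease of the sizes makes the roots simple. All parts beyond the first N are kept, so each
  infinite power sum changes by exactly the change of a finite one. Total mass is the first power
  sum and is protected as soon as N exceeds 1. The closed parts of the clique graphon share
  endpoints and miss the point 1. The work is therefore done on a half-open version in which
  adjacency is equality of colours, and the two are linked through their random graphs.\<close>

lemma fps_deriv_prod_linear:
  fixes b :: "'i \<Rightarrow> real"
  assumes "finite S"
  shows "fps_deriv (\<Prod>i\<in>S. 1 - fps_const (b i) * fps_X) =
    - (\<Prod>i\<in>S. 1 - fps_const (b i) * fps_X) * Abs_fps (\<lambda>k. \<Sum>i\<in>S. b i ^ Suc k)"
  using assms
proof (induction S rule: finite_induct)
  case empty
  then show ?case by (simp add: fps_eq_iff)
next
  case (insert a S)
  let ?P = "\<Prod>i\<in>S. 1 - fps_const (b i) * fps_X"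
  let ?S = "Abs_fps (\<lambda>k. \<Sum>i\<in>S. b i ^ Suc k)"
  let ?G = "Abs_fps (\<lambda>k. b a ^ Suc k)"
  have split: "Abs_fps (\<lambda>k. \<Sum>i\<in>insert a S. b i ^ Suc k) = ?G + ?S"
    using insert by (simp add: fps_eq_iff)
  \<comment> \<open>\<open>?G\<close> is the geometric series of b_a / (1 - b_a X), up to sign the
    contribution of the new factor to the logarithmic derivative.\<close>
  have geom: "(1 - fps_const (b a) * fps_X) * ?G = fps_const (b a)"
  proof (rule fps_ext)
    fix n
    show "fps_nth ((1 - fps_const (b a) * fps_X) * ?G) n = fps_nth (fps_const (b a)) n"
      by (cases n) (simp_all add: left_diff_distrib mult.assoc)
  qed
  have "fps_deriv (\<Prod>i\<in>insert a S. 1 - fps_const (b i) * fps_X) =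
    (1 - fps_const (b a) * fps_X) * (- ?P * ?S) + (- fps_const (b a)) * ?P"
    using insert by simp
  also have "\<dots> = - ((1 - fps_const (b a) * fps_X) * ?P) * (?G + ?S)"
  proof -
    have "u * (- p * s) + (- v) * p = - (u * p) * (g + s)" if "u * g = v" for u v p s g :: "real fps"
      using that by (auto simp: algebra_simps)
    from this[OF geom] show ?thesis .
  qed
  finally show ?case unfolding split prod.insert[OF insert.hyps] .
qed

text \<open>The logarithmic derivative of the product of the factors 1 - b_i X is minus the
  generating function of the power sums; compare the coefficients of X^k. The coefficients of
  \<open>A\<close> are the signed elementary symmetric functions and vanish beyond
  \<open>card S\<close>, so one formula serves every \<open>k\<close>.\<close>

lemma newton_identity:
  fixes b :: "'i \<Rightarrow> real"
  assumes "finite S"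
  defines "A \<equiv> \<Prod>i\<in>S. [:1, - b i:]"
  shows "real (Suc k) * coeff A (Suc k) = - (\<Sum>j=0..k. coeff A j * (\<Sum>i\<in>S. b i ^ Suc (k - j)))"
proof -
  have "fps_of_poly A = (\<Prod>i\<in>S. 1 - fps_const (b i) * fps_X)"
    unfolding A_def fps_of_poly_prod
    by (intro prod.cong refl) (simp add: fps_of_poly_pCons fps_const_neg[symmetric] del: fps_const_neg)
  then have "fps_deriv (fps_of_poly A) = - (fps_of_poly A * Abs_fps (\<lambda>k. \<Sum>i\<in>S. b i ^ Suc k))"
    using fps_deriv_prod_linear[OF assms(1), of b] by simp
  from arg_cong[OF this, of "\<lambda>F. fps_nth F k"] show ?thesis
    by (simp add: fps_mult_nth)
qed

text \<open>Newton's identities are triangular: the constant coefficient is 1, so each power sum is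
  determined by the coefficients up to its order and the lower power sums. At order \<open>N\<close>
  all lower terms cancel between the two families, which leaves \<open>N\<close> times the
  coefficient plus the power sum as a common value.\<close>

lemma power_sums_eq_iff_coeff_eq:
  fixes b r :: "'i \<Rightarrow> real"
  assumes "finite S"
  defines "A \<equiv> \<Prod>i\<in>S. [:1, - b i:]" and "B \<equiv> \<Prod>i\<in>S. [:1, - r i:]"
  assumes coeff: "\<And>k. k < N \<Longrightarrow> coeff A k = coeff B k" and "1 \<le> N"
  shows "1 \<le> k \<Longrightarrow> k < N \<Longrightarrow> (\<Sum>i\<in>S. b i ^ k) = (\<Sum>i\<in>S. r i ^ k)"
    and "(\<Sum>i\<in>S. b i ^ N) = (\<Sum>i\<in>S. r i ^ N) \<longleftrightarrow> coeff A N = coeff B N"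
proof -
  have [simp]: "coeff A 0 = 1" "coeff B 0 = 1"
    by (simp_all add: A_def B_def poly_0_coeff_0[symmetric] poly_prod)
  have split: "(\<Sum>j=0..k. coeff Q j * s (k - j)) = coeff Q 0 * s k + (\<Sum>j=1..k. coeff Q j * s (k - j))"
    for Q :: "real poly" and s k by (simp add: sum.atLeast_Suc_atMost)
  have A: "real (Suc k) * coeff A (Suc k) =
      - (\<Sum>i\<in>S. b i ^ Suc k) - (\<Sum>j=1..k. coeff A j * (\<Sum>i\<in>S. b i ^ Suc (k - j)))" for k
    using newton_identity[OF assms(1), of k b, folded A_def] split[of A "\<lambda>k. \<Sum>i\<in>S. b i ^ Suc k" k]
    by simp
  have B: "real (Suc k) * coeff B (Suc k) =
      - (\<Sum>i\<in>S. r i ^ Suc k) - (\<Sum>j=1..k. coeff B j * (\<Sum>i\<in>S. r i ^ Suc (k - j)))" for k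
    using newton_identity[OF assms(1), of k r, folded B_def] split[of B "\<lambda>k. \<Sum>i\<in>S. r i ^ Suc k" k]
    by simp
  have eq: "1 \<le> k \<longrightarrow> k < N \<longrightarrow> (\<Sum>i\<in>S. b i ^ k) = (\<Sum>i\<in>S. r i ^ k)" for k
  proof (induction k rule: less_induct)
    case (less k)
    show ?case
    proof (intro impI)
      assume k: "1 \<le> k" "k < N"
      then obtain m where m: "k = Suc m" by (cases k) auto
      have "(\<Sum>j=1..m. coeff A j * (\<Sum>i\<in>S. b i ^ Suc (m - j))) =
            (\<Sum>j=1..m. coeff B j * (\<Sum>i\<in>S. r i ^ Suc (m - j)))"
        using k m coeff
        by (intro sum.cong refl arg_cong2[of _ _ _ _ "(*)"] less.IH[rule_format]) auto
      then show "(\<Sum>i\<in>S. b i ^ k) = (\<Sum>i\<in>S. r i ^ k)"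
        using A[of m] B[of m] coeff[of k] k m by simp
    qed
  qed
  then show "1 \<le> k \<Longrightarrow> k < N \<Longrightarrow> (\<Sum>i\<in>S. b i ^ k) = (\<Sum>i\<in>S. r i ^ k)" by simp
  obtain m where m: "N = Suc m" using \<open>1 \<le> N\<close> by (cases N) auto
  have "(\<Sum>j=1..m. coeff A j * (\<Sum>i\<in>S. b i ^ Suc (m - j))) =
        (\<Sum>j=1..m. coeff B j * (\<Sum>i\<in>S. r i ^ Suc (m - j)))"
    using m coeff
    by (intro sum.cong refl arg_cong2[of _ _ _ _ "(*)"] eq[rule_format]) auto
  then have "real N * coeff A N + (\<Sum>i\<in>S. b i ^ N) = real N * coeff B N + (\<Sum>i\<in>S. r i ^ N)"
    using A[of m] B[of m] m by (simp add: algebra_simps)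
  moreover have "0 < real N" using \<open>1 \<le> N\<close> by simp
  ultimately show "(\<Sum>i\<in>S. b i ^ N) = (\<Sum>i\<in>S. r i ^ N) \<longleftrightarrow> coeff A N = coeff B N"
    by auto
qed

text \<open>The sign of the product alternates along points \<open>t 0\<close>, ...,
  \<open>t N\<close> that separate its roots. A perturbation smaller than its absolute values there
  keeps these signs, so the intermediate value theorem gives \<open>N\<close> distinct positive
  roots, and the \<open>r i\<close> are their reciprocals.\<close>

lemma ex_perturbed_roots:
  fixes b :: "nat \<Rightarrow> real"
  assumes "1 \<le> N" and dec: "\<And>i. b (Suc i) < b i" and pos: "\<And>i. 0 < b i"
  obtains r \<epsilon> where "0 < \<epsilon>" "\<And>i. i < N \<Longrightarrow> 0 < r i"
    "(\<Prod>i<N. [:1, - r i:]) = (\<Prod>i<N. [:1, - b i:]) - monom \<epsilon> N"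
proof -
  define A where "A = (\<Prod>i<N. [:1, - b i:])"
  have poly_A: "poly A x = (\<Prod>i<N. 1 - b i * x)" for x
    by (simp add: A_def poly_prod mult.commute)
  \<comment> \<open>points that separate the roots \<open>1 / b i\<close> from each other\<close>
  define t where "t i = (case i of 0 \<Rightarrow> 1 / (b 0 + 1) | Suc i \<Rightarrow> 2 / (b i + b (Suc i)))" for i
  have t_below: "b i * t i < 1" for i
    using dec pos[of i] pos[of "i - 1"] by (cases i) (auto simp: t_def divide_simps)
  have t_above: "1 < b i * t (Suc i)" for i
    using dec[of i] pos[of i] pos[of "Suc i"] by (auto simp: t_def divide_simps)
  have t_pos: "0 < t i" for i
    using pos by (auto simp: t_def add_pos_pos split: nat.split)
  have t_Suc: "t i < t (Suc i)" for i
  proof -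
    have "b i * t i < b i * t (Suc i)" using t_below[of i] t_above[of i] by linarith
    then show ?thesis using pos[of i] by simp
  qed
  then have t_mono: "strict_mono t" by (simp add: strict_mono_Suc_iff)
  \<comment> \<open>Only the factor of index \<open>i\<close> changes sign between the two points:
    factors of smaller index are negative at both, factors of larger index positive at both.\<close>
  have sign: "poly A (t i) * poly A (t (Suc i)) < 0" if "i < N" for i
  proof -
    let ?f = "\<lambda>j. (1 - b j * t i) * (1 - b j * t (Suc i))"
    have "poly A (t i) * poly A (t (Suc i)) = (\<Prod>j<N. ?f j)"
      by (simp add: poly_A prod.distrib)
    also have "\<dots> = ?f i * (\<Prod>j\<in>{..<N} - {i}. ?f j)"
      using that by (subst prod.remove[of _ i]) auto
    also have "\<dots> < 0"
    proof (rule mult_neg_pos)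
      show "?f i < 0" using t_below[of i] t_above[of i] by (simp add: mult_pos_neg)
      show "0 < (\<Prod>j\<in>{..<N} - {i}. ?f j)"
      proof (intro prod_pos ballI)
        fix j assume "j \<in> {..<N} - {i}"
        then consider "j < i" | "i < j" by force
        then show "0 < ?f j"
        proof cases
          case 1
          then have "t (Suc j) \<le> t i" "t (Suc j) \<le> t (Suc i)"
            using t_mono by (auto simp: strict_mono_less_eq)
          then have "b j * t (Suc j) \<le> b j * t i" "b j * t (Suc j) \<le> b j * t (Suc i)"
            using pos[of j] by simp_all
          then show ?thesis using t_above[of j] by (intro mult_neg_neg) linarith+
        next
          case 2
          then have "t i \<le> t j" "t (Suc i) \<le> t j"
            using t_mono by (auto simp: strict_mono_less_eq)
          then have "b j * t i \<le> b j * t j" "b j * t (Suc i) \<le> b j * t j"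
            using pos[of j] by simp_all
          then show ?thesis using t_below[of j] by (intro mult_pos_pos) linarith+
        qed
      qed
    qed
    finally show ?thesis .
  qed
  have nz: "poly A (t i) \<noteq> 0" if "i \<le> N" for i
    using sign[of i] sign[of "i - 1"] that \<open>1 \<le> N\<close> by (cases i; cases "i < N") auto
  \<comment> \<open>Halving the minimum makes the bound strict at all N + 1 points, so subtracting
    the monomial cannot change a sign.\<close>
  define \<epsilon> where "\<epsilon> = Min ((\<lambda>i. \<bar>poly A (t i)\<bar> / t i ^ N) ` {..N}) / 2"
  have "0 < Min ((\<lambda>i. \<bar>poly A (t i)\<bar> / t i ^ N) ` {..N})"
    using nz t_pos by (subst Min_gr_iff) auto
  then have \<epsilon>: "0 < \<epsilon>" "2 * \<epsilon> = Min ((\<lambda>i. \<bar>poly A (t i)\<bar> / t i ^ N) ` {..N})"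
    by (simp_all add: \<epsilon>_def)
  have small: "\<epsilon> * t i ^ N < \<bar>poly A (t i)\<bar>" "0 < \<epsilon> * t i ^ N" if "i \<le> N" for i
  proof -
    have "2 * \<epsilon> \<le> \<bar>poly A (t i)\<bar> / t i ^ N"
      unfolding \<epsilon>(2) using that by (intro Min_le) auto
    then have "\<epsilon> < \<bar>poly A (t i)\<bar> / t i ^ N" using \<epsilon>(1) by linarith
    then show "\<epsilon> * t i ^ N < \<bar>poly A (t i)\<bar>" using t_pos[of i] by (simp add: pos_less_divide_eq)
    show "0 < \<epsilon> * t i ^ N" using \<epsilon>(1) t_pos[of i] by simp
  qed
  define Q where "Q = A - monom \<epsilon> N"
  have Q: "poly Q x = poly A x - \<epsilon> * x ^ N" for x by (simp add: Q_def poly_monom)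
  have "\<exists>u. t i < u \<and> u < t (Suc i) \<and> poly Q u = 0" if "i < N" for i
  proof -
    have "poly Q (t i) * poly Q (t (Suc i)) < 0"
      using sign[OF that] small[of i] small[of "Suc i"] that
      unfolding Q mult_less_0_iff by (auto simp: abs_if split: if_splits)
    then show ?thesis using poly_IVT[OF t_Suc[of i], of Q] by auto
  qed
  then obtain u where u: "\<And>i. i < N \<Longrightarrow> t i < u i" "\<And>i. i < N \<Longrightarrow> u i < t (Suc i)"
    "\<And>i. i < N \<Longrightarrow> poly Q (u i) = 0" by metis
  have u_pos: "0 < u i" if "i < N" for i using u(1)[OF that] t_pos[of i] by linarith
  have u_less: "u i < u j" if "i < j" "j < N" for i j
  proof -
    have "u i < t (Suc i)" using u(2) that by simp
    also have "\<dots> \<le> t j" using t_mono that by (auto simp: strict_mono_less_eq)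
    also have "\<dots> < u j" using u(1) that by simp
    finally show ?thesis .
  qed
  then have inj: "inj_on u {..<N}"
    by (force intro!: linorder_inj_onI)
  define r where "r i = 1 / u i" for i
  define B where "B = (\<Prod>i<N. [:1, - r i:])"
  have poly_B: "poly B x = (\<Prod>i<N. 1 - r i * x)" for x
    by (simp add: B_def poly_prod mult.commute)
  have deg: "degree (\<Prod>i<N. [:1, - c i:]) \<le> N" for c :: "nat \<Rightarrow> real"
  proof -
    have "degree (\<Prod>i<N. [:1, - c i:]) \<le> (\<Sum>i<N. degree [:1, - c i:])"
      using degree_prod_sum_le[of "{..<N}" "\<lambda>i. [:1, - c i:]"] by (simp add: comp_def)
    also have "\<dots> \<le> (\<Sum>i<N. 1)" by (intro sum_mono) simp
    finally show ?thesis by simp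
  qed
  have "Q = B"
  proof (rule ccontr)
    assume "Q \<noteq> B"
    then have "Q - B \<noteq> 0" by simp
    have "degree (Q - B) \<le> N"
      using deg[of b] deg[of r] by (auto simp: Q_def A_def B_def degree_monom_eq intro!: degree_diff_le degree_monom_le)
    \<comment> \<open>Both polynomials have constant coefficient 1, so 0 is a zero of the difference
      besides the \<open>N\<close> points \<open>u i\<close>: one zero too many for degree at most
      \<open>N\<close>.\<close>
    have "insert 0 (u ` {..<N}) \<subseteq> {x. poly (Q - B) x = 0}"
    proof -
      have "poly (Q - B) 0 = 0" using \<open>1 \<le> N\<close> by (simp add: Q poly_A poly_B)
      moreover have "poly B (u i) = 0" if "i < N" for i
        unfolding poly_B using that u_pos[OF that] by (intro prod_zero bexI[of _ i]) (auto simp: r_def)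
      ultimately show ?thesis using u(3) by auto
    qed
    then have "card (insert 0 (u ` {..<N})) \<le> card {x. poly (Q - B) x = 0}"
      using poly_roots_finite[OF \<open>Q - B \<noteq> 0\<close>] by (rule card_mono[rotated])
    moreover have "card (insert 0 (u ` {..<N})) = Suc N"
      using u_pos inj by (subst card_insert_disjoint) (force simp: card_image)+
    ultimately show False
      using card_poly_roots_bound[OF \<open>Q - B \<noteq> 0\<close>] \<open>degree (Q - B) \<le> N\<close> by linarith
  qed
  then show thesis
    using that[of \<epsilon> r] \<epsilon>(1) u_pos by (simp add: Q_def A_def B_def r_def)
qed

lemma ex_power_sums_agree_below:
  fixes b :: "nat \<Rightarrow> real"
  assumes "1 \<le> N" and dec: "\<And>i. b (Suc i) < b i" and pos: "\<And>i. 0 < b i"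
  obtains r where "\<And>i. i < N \<Longrightarrow> 0 < r i"
    "\<And>k. 1 \<le> k \<Longrightarrow> k < N \<Longrightarrow> (\<Sum>i<N. r i ^ k) = (\<Sum>i<N. b i ^ k)"
    "(\<Sum>i<N. r i ^ N) \<noteq> (\<Sum>i<N. b i ^ N)"
proof -
  obtain r \<epsilon> where r: "0 < \<epsilon>" "\<And>i. i < N \<Longrightarrow> 0 < r i"
    "(\<Prod>i<N. [:1, - r i:]) = (\<Prod>i<N. [:1, - b i:]) - monom \<epsilon> N"
    using ex_perturbed_roots[of N b] assms by metis
  have coeff: "coeff (\<Prod>i<N. [:1, - r i:]) k = coeff (\<Prod>i<N. [:1, - b i:]) k - (if k = N then \<epsilon> else 0)" for k
    by (simp add: r(3))
  show thesis
  proof (rule that)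
    show "0 < r i" if "i < N" for i using r(2) that .
    show "(\<Sum>i<N. r i ^ k) = (\<Sum>i<N. b i ^ k)" if "1 \<le> k" "k < N" for k
      using power_sums_eq_iff_coeff_eq(1)[of "{..<N}" N r b k] coeff that \<open>1 \<le> N\<close> by simp
    show "(\<Sum>i<N. r i ^ N) \<noteq> (\<Sum>i<N. b i ^ N)"
      using power_sums_eq_iff_coeff_eq(2)[of "{..<N}" N r b] coeff r(1) \<open>1 \<le> N\<close> by simp
  qed
qed

section \<open>Equality patterns of independent samples\<close>

text \<open>Supports are countable, so intersecting both sides with them reduces the claim to
  countable rectangles.\<close>

lemma prob_pair_pmf_Times:
  "measure_pmf.prob (pair_pmf M N) (A \<times> B) = measure_pmf.prob M A * measure_pmf.prob N B"
proof -
  have "measure_pmf.prob (pair_pmf M N) (A \<times> B) =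
      measure_pmf.prob (pair_pmf M N) ((A \<inter> set_pmf M) \<times> (B \<inter> set_pmf N))"
    by (subst measure_Int_set_pmf[symmetric]) (simp add: Times_Int_Times)
  also have "\<dots> = measure_pmf.prob M A * measure_pmf.prob N B"
    by (simp add: measure_pmf_prob_product measure_Int_set_pmf)
  finally show ?thesis .
qed

text \<open>Split by the common colour \<open>k\<close>; the pieces are disjoint because
  \<open>B\<close> has an element that shows the colour.\<close>

lemma prob_Pi_pmf_constant:
  fixes p :: "nat pmf"
  assumes "finite B" "B \<noteq> {}"
  shows "measure_pmf.prob (Pi_pmf B d (\<lambda>_. p)) {c. \<forall>i\<in>B. \<forall>j\<in>B. c i = c j} =
    (\<Sum>k. pmf p k ^ card B)"
proof -
  have UN: "{c. \<forall>i\<in>B. \<forall>j\<in>B. c i = c j} = (\<Union>k. Pi B (\<lambda>_. {k}))"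
    using assms(2) by (auto simp: Pi_def)
  have "disjoint_family (\<lambda>k. Pi B (\<lambda>_. {k}))"
    using assms(2) by (fastforce simp: disjoint_family_on_def Pi_def)
  then have "(\<lambda>k. measure_pmf.prob (Pi_pmf B d (\<lambda>_. p)) (Pi B (\<lambda>_. {k}))) sums
      measure_pmf.prob (Pi_pmf B d (\<lambda>_. p)) (\<Union>k. Pi B (\<lambda>_. {k}))"
    by (intro measure_pmf.finite_measure_UNION) auto
  then show ?thesis
    unfolding UN using assms(1) by (simp add: measure_Pi_pmf_Pi measure_pmf_single sums_iff)
qed

text \<open>Colours on disjoint blocks are independent, and nothing is demanded across blocks, so
  the probabilities multiply.\<close>

lemma prob_Pi_pmf_constant_on_blocks:
  fixes p :: "nat pmf"
  assumes "finite Q" "\<And>B. B \<in> Q \<Longrightarrow> finite B" "\<And>B. B \<in> Q \<Longrightarrow> B \<noteq> {}" "disjoint Q"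
  shows "measure_pmf.prob (Pi_pmf (\<Union>Q) d (\<lambda>_. p)) {c. \<forall>B\<in>Q. \<forall>i\<in>B. \<forall>j\<in>B. c i = c j} =
    (\<Prod>B\<in>Q. \<Sum>k. pmf p k ^ card B)"
  using assms
proof (induction Q rule: finite_induct)
  case empty
  then show ?case by simp
next
  case (insert B Q)
  have disj: "B \<inter> B' = {}" if "B' \<in> Q" for B'
    using insert.hyps insert.prems(3) that by (auto simp: disjoint_def)
  define const where "const A c \<longleftrightarrow> (\<forall>i\<in>A. \<forall>j\<in>A. c i = c j)" for A :: "'a set" and c :: "'a \<Rightarrow> nat"
  define merge where "merge = (\<lambda>(f, g) x. if x \<in> B then f x else g x :: nat)"
  let ?P = "\<lambda>A. Pi_pmf A d (\<lambda>_. p)"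
  have left: "const B (merge h) \<longleftrightarrow> const B (fst h)" for h
    by (cases h) (simp add: const_def merge_def)
  have right: "const B' (merge h) \<longleftrightarrow> const B' (snd h)" if "B' \<in> Q" for B' h
  proof -
    have "merge h x = snd h x" if "x \<in> B'" for x
      using disj[OF \<open>B' \<in> Q\<close>] that by (cases h) (auto simp: merge_def)
    then show ?thesis by (simp add: const_def)
  qed
  \<comment> \<open>Sampling on the union amounts to sampling on the new block and on the rest
    independently and gluing with \<open>merge\<close>; under this gluing the event becomes a
    rectangle.\<close>
  have "?P (\<Union>(insert B Q)) = map_pmf merge (pair_pmf (?P B) (?P (\<Union>Q)))"
    unfolding Union_insert merge_def using insert.hyps insert.prems(1) disj
    by (intro Pi_pmf_union) auto
  moreover have "merge -` {c. \<forall>B\<in>insert B Q. const B c} = {f. const B f} \<times> {g. \<forall>B\<in>Q. const B g}"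
    by (intro set_eqI) (simp add: left right mem_Times_iff)
  ultimately have "measure_pmf.prob (?P (\<Union>(insert B Q))) {c. \<forall>B\<in>insert B Q. const B c} =
      measure_pmf.prob (pair_pmf (?P B) (?P (\<Union>Q))) ({f. const B f} \<times> {g. \<forall>B\<in>Q. const B g})"
    by (simp only: measure_map_pmf)
  also have "\<dots> = measure_pmf.prob (?P B) {f. const B f} * measure_pmf.prob (?P (\<Union>Q)) {g. \<forall>B\<in>Q. const B g}"
    by (rule prob_pair_pmf_Times)
  also have "measure_pmf.prob (?P (\<Union>Q)) {g. \<forall>B\<in>Q. const B g} = (\<Prod>B\<in>Q. \<Sum>k. pmf p k ^ card B)"
    unfolding const_def using insert.prems by (intro insert.IH) (simp_all add: pairwise_insert)
  also have "measure_pmf.prob (?P B) {f. const B f} = (\<Sum>k. pmf p k ^ card B)"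
    unfolding const_def by (intro prob_Pi_pmf_constant) (simp_all add: insert.prems)
  finally show ?case unfolding const_def prod.insert[OF insert.hyps] .
qed

text \<open>Moebius inversion over the inclusion order.\<close>

lemma set_pmf_eqI_superset_probs:
  fixes M N :: "'a set pmf"
  assumes "finite \<R>" "set_pmf M \<subseteq> \<R>" "set_pmf N \<subseteq> \<R>" "\<And>R. R \<in> \<R> \<Longrightarrow> finite R"
    and eq: "\<And>R. R \<in> \<R> \<Longrightarrow> measure_pmf.prob M {X. R \<subseteq> X} = measure_pmf.prob N {X. R \<subseteq> X}"
  shows "M = N"
proof (rule pmf_eqI)
  have sum_above: "measure_pmf.prob L {X. R \<subseteq> X} = pmf L R + (\<Sum>X\<in>{X\<in>\<R>. R \<subset> X}. pmf L X)"
    if "set_pmf L \<subseteq> \<R>" "R \<in> \<R>" for L R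
  proof -
    have "measure_pmf.prob L {X. R \<subseteq> X} = measure_pmf.prob L {X\<in>\<R>. R \<subseteq> X}"
      using that by (intro measure_prob_cong_0) (auto simp: set_pmf_eq)
    also have "\<dots> = (\<Sum>X\<in>{X\<in>\<R>. R \<subseteq> X}. pmf L X)"
      using assms(1) by (simp add: measure_measure_pmf_finite)
    also have "{X\<in>\<R>. R \<subseteq> X} = insert R {X\<in>\<R>. R \<subset> X}" using that by auto
    finally show ?thesis using assms(1) by (subst (asm) sum.insert) auto
  qed
  have fin: "finite (\<Union>\<R>)" using assms by auto
  fix R
  show "pmf M R = pmf N R"
  proof (cases "R \<in> \<R>")
    case True
    then show ?thesis
    \<comment> \<open>Downward induction: strict supersets have a smaller complement, so their
      masses are already known to agree.\<close>
    proof (induction "card (\<Union>\<R> - R)" arbitrary: R rule: less_induct)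
      case less
      have "pmf M X = pmf N X" if "X \<in> \<R>" "R \<subset> X" for X
        using that fin by (intro less psubset_card_mono) auto
      then have "(\<Sum>X\<in>{X\<in>\<R>. R \<subset> X}. pmf M X) = (\<Sum>X\<in>{X\<in>\<R>. R \<subset> X}. pmf N X)"
        by (intro sum.cong) auto
      then show ?case
        using sum_above[OF assms(2) less.prems] sum_above[OF assms(3) less.prems] eq[OF less.prems]
        by simp
    qed
  next
    case False
    then have "R \<notin> set_pmf M" "R \<notin> set_pmf N" using assms by auto
    then show ?thesis by (simp add: set_pmf_eq)
  qed
qed

text \<open>Forgets the names of the colours and keeps just what the graph depends on. Cutting off
  at \<open>n\<close> leaves only finitely many possible values, as the inversion needs.\<close>

definition kernel_on :: "nat \<Rightarrow> (nat \<Rightarrow> 'a) \<Rightarrow> (nat \<times> nat) set" where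
  "kernel_on n c = {(i, j). i < n \<and> j < n \<and> c i = c j}"

lemma equiv_kernel_on: "equiv {..<n} (kernel_on n c)"
  by (intro equivI) (auto simp: kernel_on_def refl_on_def sym_def trans_def)

lemma finite_equivs: "finite {R. equiv {..<n::nat} R}"
  by (rule finite_subset[of _ "Pow ({..<n} \<times> {..<n})"]) (use equiv_type in blast, simp)

text \<open>Containing \<open>R\<close> means being constant on each of its classes, which are
  disjoint blocks. Equality with \<open>R\<close> would also force distinct classes to differ in
  colour and would break the product.\<close>

lemma prob_kernel_on_superset:
  fixes p :: "nat pmf"
  assumes R: "equiv {..<n} R"
  shows "measure_pmf.prob (Pi_pmf {..<n} d (\<lambda>_. p)) {c. R \<subseteq> kernel_on n c} =
    (\<Prod>B\<in>{..<n} // R. \<Sum>k. pmf p k ^ card B)"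
proof -
  have "R \<subseteq> kernel_on n c \<longleftrightarrow> (\<forall>B\<in>{..<n} // R. \<forall>i\<in>B. \<forall>j\<in>B. c i = c j)" for c :: "nat \<Rightarrow> nat"
  proof
    assume "R \<subseteq> kernel_on n c"
    moreover have "(i, j) \<in> R" if "B \<in> {..<n} // R" "i \<in> B" "j \<in> B" for B i j
      using in_quotient_imp_in_rel[OF R that(1)] that by simp
    ultimately show "\<forall>B\<in>{..<n} // R. \<forall>i\<in>B. \<forall>j\<in>B. c i = c j"
      by (fastforce simp: kernel_on_def)
  next
    assume *: "\<forall>B\<in>{..<n} // R. \<forall>i\<in>B. \<forall>j\<in>B. c i = c j"
    show "R \<subseteq> kernel_on n c"
    proof (rule subrelI)
      fix i j assume ij: "(i, j) \<in> R"
      then have n: "i < n" "j < n" using equiv_type[OF R] by auto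
      have "R `` {i} \<in> {..<n} // R" using n by (simp add: quotientI)
      moreover have "i \<in> R `` {i}" "j \<in> R `` {i}"
        using ij n equiv_class_self[OF R, of i] by simp_all
      ultimately have "c i = c j" using *[rule_format, of "R `` {i}" i j] by simp
      then show "(i, j) \<in> kernel_on n c" using n by (simp add: kernel_on_def)
    qed
  qed
  moreover have "\<Union>({..<n} // R) = {..<n}" using Union_quotient[OF R] .
  moreover have "finite ({..<n} // R)" by (rule finite_quotient) (use equiv_type[OF R] in simp_all)
  moreover have "finite B" if "B \<in> {..<n} // R" for B
    using in_quotient_imp_subset[OF R that] by (rule finite_subset) simp
  moreover have "disjoint ({..<n} // R)" using quotient_disj[OF R] unfolding disjoint_def by blast
  ultimately show ?thesis
    using prob_Pi_pmf_constant_on_blocks[of "{..<n} // R" d p] in_quotient_imp_non_empty[OF R]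
    by simp
qed

text \<open>A class of an equivalence relation on \<open>n\<close> points has between 1 and
  \<open>n\<close> elements, so all superset probabilities agree, and these determine the law of the
  pattern.\<close>

lemma map_kernel_on_cong:
  fixes p q :: "nat pmf"
  assumes "\<And>k. 1 \<le> k \<Longrightarrow> k \<le> n \<Longrightarrow> (\<Sum>i. pmf p i ^ k) = (\<Sum>i. pmf q i ^ k)"
  shows "map_pmf (kernel_on n) (Pi_pmf {..<n} d (\<lambda>_. p)) = map_pmf (kernel_on n) (Pi_pmf {..<n} d (\<lambda>_. q))"
proof (rule set_pmf_eqI_superset_probs)
  show "finite {R. equiv {..<n} R}" by (rule finite_equivs)
  show "finite R" if "R \<in> {R. equiv {..<n} R}" for R
    using that equiv_type by (intro finite_subset[of R "{..<n} \<times> {..<n}"]) auto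
  show "set_pmf (map_pmf (kernel_on n) (Pi_pmf {..<n} d (\<lambda>_. p))) \<subseteq> {R. equiv {..<n} R}"
    "set_pmf (map_pmf (kernel_on n) (Pi_pmf {..<n} d (\<lambda>_. q))) \<subseteq> {R. equiv {..<n} R}"
    using equiv_kernel_on by auto
  fix R assume "R \<in> {R. equiv {..<n} R}"
  then have R: "equiv {..<n} R" by simp
  have "(\<Prod>B\<in>{..<n} // R. \<Sum>k. pmf p k ^ card B) = (\<Prod>B\<in>{..<n} // R. \<Sum>k. pmf q k ^ card B)"
  proof (intro prod.cong refl assms)
    fix B assume B: "B \<in> {..<n} // R"
    have "B \<subseteq> {..<n}" using in_quotient_imp_subset[OF R B] .
    moreover have "B \<noteq> {}" using in_quotient_imp_non_empty[OF R B] .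
    ultimately show "1 \<le> card B" "card B \<le> n"
      using card_mono[of "{..<n}" B] by (auto simp: Suc_le_eq card_gt_0_iff intro: finite_subset)
  qed
  then show "measure_pmf.prob (map_pmf (kernel_on n) (Pi_pmf {..<n} d (\<lambda>_. p))) {X. R \<subseteq> X} =
      measure_pmf.prob (map_pmf (kernel_on n) (Pi_pmf {..<n} d (\<lambda>_. q))) {X. R \<subseteq> X}"
    using prob_kernel_on_superset[OF R] by simp
qed

lemma prob_kernel_on_full:
  fixes p :: "nat pmf"
  assumes "1 \<le> n"
  shows "measure_pmf.prob (Pi_pmf {..<n} d (\<lambda>_. p)) {c. kernel_on n c = {..<n} \<times> {..<n}} =
    (\<Sum>k. pmf p k ^ n)"
proof -
  have "{c :: nat \<Rightarrow> nat. kernel_on n c = {..<n} \<times> {..<n}} = {c. \<forall>i\<in>{..<n}. \<forall>j\<in>{..<n}. c i = c j}"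
    by (auto simp: kernel_on_def set_eq_iff)
  then show ?thesis using prob_Pi_pmf_constant[of "{..<n}" d p] assms by (simp add: lessThan_empty_iff)
qed

section \<open>Random graphs of colour-class graphons\<close>

lemma prob_space_unif01: "prob_space unif01"
  unfolding unif01_def by (rule prob_space_restrict_space) auto

lemma space_unif01 [simp]: "space unif01 = {0..1}"
  by (simp add: unif01_def space_restrict_space)

lemma sets_unif01_iff: "A \<in> sets unif01 \<longleftrightarrow> A \<subseteq> {0..1} \<and> A \<in> sets borel"
  by (simp add: unif01_def sets_restrict_space_iff)

lemma emeasure_unif01: "A \<subseteq> {0..1} \<Longrightarrow> emeasure unif01 A = emeasure lborel A"
  unfolding unif01_def by (rule emeasure_restrict_space) auto

lemma measurable_unif01I:
  "f \<in> borel_measurable M \<Longrightarrow> (\<And>x. x \<in> space M \<Longrightarrow> f x \<in> {0..1}) \<Longrightarrow> f \<in> measurable M unif01"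
  unfolding unif01_def by (rule measurable_restrict_space2) auto

lemma measurable_from_unif01:
  "f \<in> measurable M unif01 \<Longrightarrow> f \<in> borel_measurable M"
  unfolding unif01_def by (simp add: measurable_restrict_space2_iff)

lemma AE_unif01I: "AE x in lborel. P x \<Longrightarrow> AE x in unif01. P x"
  unfolding unif01_def by (subst AE_restrict_space_iff) auto

lemma AE_unif01_notin_countable:
  assumes "countable N"
  shows "AE x in unif01. x \<notin> N"
proof (rule AE_unif01I, rule AE_I')
  show "N \<in> null_sets lborel" using assms by (rule countable_imp_null_set_lborel)
qed auto

text \<open>Only finitely many truth values enter, so the set of true indices ranges over a finite
  space on which every \<open>g\<close> is measurable. Graphs and permutations built from
  comparisons thus need no measurability argument of their own.\<close>

lemma measurable_finite_relation:
  assumes "finite I" "\<And>q. q \<in> I \<Longrightarrow> Measurable.pred M (P q)"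
  shows "(\<lambda>x. g {q\<in>I. P q x}) \<in> measurable M (count_space UNIV)"
proof -
  have "(\<lambda>x. {q\<in>I. P q x}) -` {R} \<inter> space M \<in> sets M" if "R \<in> Pow I" for R
  proof -
    have "(\<lambda>x. {q\<in>I. P q x}) -` {R} \<inter> space M = {x\<in>space M. \<forall>q\<in>I. P q x \<longleftrightarrow> q \<in> R}"
      using that by auto
    also have "\<dots> \<in> sets M"
    proof -
      have "Measurable.pred M (\<lambda>x. \<forall>q\<in>I. P q x \<longleftrightarrow> q \<in> R)"
        using assms by (intro pred_intros_finite pred_intros_logic) auto
      then show ?thesis by (simp add: pred_def)
    qed
    finally show ?thesis .
  qed
  then have "(\<lambda>x. {q\<in>I. P q x}) \<in> measurable M (count_space (Pow I))"
    using assms(1) by (subst measurable_count_space_eq2) auto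
  moreover have "g \<in> measurable (count_space (Pow I)) (count_space UNIV)"
    by simp
  ultimately show ?thesis by (rule measurable_compose)
qed

section \<open>Random graphs as images of the sampled points\<close>

abbreviation sample :: "nat \<Rightarrow> (nat \<Rightarrow> real) measure" where
  "sample n \<equiv> \<Pi>\<^sub>M i\<in>{..<n}. unif01"

lemma prob_space_sample: "prob_space (sample n)"
  by (intro prob_space_PiM prob_space_unif01)

text \<open>Looks only at pairs with \<open>i < j\<close>, so \<open>R\<close> may be neither
  symmetric nor irreflexive; in particular \<open>UNIV\<close> yields the complete graph.\<close>

definition graph_of_rel :: "nat \<Rightarrow> (nat \<times> nat) set \<Rightarrow> nat ugraph" where
  "graph_of_rel n R = \<lparr>verts = {..<n}, edges = {{i, j} |i j. i < j \<and> j < n \<and> (i, j) \<in> R}\<rparr>"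

lemma graph_of_rel_cong:
  assumes "\<And>i j. i < j \<Longrightarrow> j < n \<Longrightarrow> (i, j) \<in> R \<longleftrightarrow> (i, j) \<in> S"
  shows "graph_of_rel n R = graph_of_rel n S"
  unfolding graph_of_rel_def using assms by auto

lemma measurable_graph_of_rel:
  assumes "\<And>i j. i < j \<Longrightarrow> j < n \<Longrightarrow> Measurable.pred M (P i j)"
  shows "(\<lambda>x. graph_of_rel n {(i, j). P i j x}) \<in> measurable M (count_space UNIV)"
proof -
  let ?I = "{(i, j). i < j \<and> j < n}"
  have "(\<lambda>x. graph_of_rel n {q\<in>?I. case_prod P q x}) \<in> measurable M (count_space UNIV)"
  proof (rule measurable_finite_relation)
    show "finite ?I" by (rule finite_subset[of _ "{..<n} \<times> {..<n}"]) auto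
  qed (use assms in auto)
  also have "(\<lambda>x. graph_of_rel n {q\<in>?I. case_prod P q x}) = (\<lambda>x. graph_of_rel n {(i, j). P i j x})"
    by (intro ext graph_of_rel_cong) auto
  finally show ?thesis .
qed

lemma sample_nth_measurable [measurable (raw)]:
  "i < n \<Longrightarrow> (\<lambda>x. x i) \<in> measurable (sample n) unif01"
  by (rule measurable_component_singleton) simp

lemma pred_W_eq_1:
  assumes "case_prod W \<in> borel_measurable (unif01 \<Otimes>\<^sub>M unif01)" "i < n" "j < n"
  shows "Measurable.pred (sample n) (\<lambda>x. W (x i) (x j) = (1::real))"
proof -
  have "(\<lambda>x. (x i, x j)) \<in> measurable (sample n) (unif01 \<Otimes>\<^sub>M unif01)"
    using assms(2,3) by (intro measurable_Pair sample_nth_measurable)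
  then have [measurable]: "(\<lambda>x. case_prod W (x i, x j)) \<in> borel_measurable (sample n)"
    by (rule measurable_compose) (rule assms(1))
  have "Measurable.pred (sample n) (\<lambda>x. case_prod W (x i, x j) = 1)" by measurable
  then show ?thesis by simp
qed

text \<open>Coins of bias 0 or 1 are deterministic, so the mixture over samples collapses to an
  image measure.\<close>

lemma W_random_graph_zero_one:
  assumes W: "case_prod W \<in> borel_measurable (unif01 \<Otimes>\<^sub>M unif01)"
    and zero_one: "\<And>x y. W x y \<in> {0, 1}"
  shows "W_random_graph n W =
    distr (sample n) (count_space UNIV) (\<lambda>x. graph_of_rel n {(i, j). W (x i) (x j) = 1})"
proof -
  have bernoulli: "bernoulli_pmf (W s t) = return_pmf (W s t = 1)" for s t
  proof (rule pmf_eqI)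
    fix c show "pmf (bernoulli_pmf (W s t)) c = pmf (return_pmf (W s t = 1)) c"
      using zero_one[of s t] by (cases c) auto
  qed
  have fin: "finite {(i, j). i < j \<and> j < n}"
    by (rule finite_subset[of _ "{..<n} \<times> {..<n}"]) auto
  have "edge_sampling_pmf n W x = return_pmf (graph_of_rel n {(i, j). W (x i) (x j) = 1})" for x
  proof -
    have "Pi_pmf {(i, j). i < j \<and> j < n} False (\<lambda>(i, j). bernoulli_pmf (W (x i) (x j))) =
        Pi_pmf {(i, j). i < j \<and> j < n} False (\<lambda>q. return_pmf (case q of (i, j) \<Rightarrow> W (x i) (x j) = 1))"
      by (intro Pi_pmf_cong) (auto simp: bernoulli)
    also have "\<dots> = return_pmf (\<lambda>q. if q \<in> {(i, j). i < j \<and> j < n} then case q of (i, j) \<Rightarrow> W (x i) (x j) = 1 else False)"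
      using fin by (rule Pi_pmf_return_pmf)
    finally show ?thesis
      by (auto simp: edge_sampling_pmf_def graph_of_rel_def intro!: arg_cong[where f = return_pmf])
  qed
  then have "W_random_graph n W = sample n \<bind>
      (\<lambda>x. return (count_space UNIV) (graph_of_rel n {(i, j). W (x i) (x j) = 1}))"
    by (simp add: W_random_graph_def return_pmf.rep_eq)
  also have "\<dots> = distr (sample n) (count_space UNIV) (\<lambda>x. graph_of_rel n {(i, j). W (x i) (x j) = 1})"
    using W by (intro bind_return_distr' measurable_graph_of_rel pred_W_eq_1)
      (auto simp: space_PiM PiE_eq_empty_iff)
  finally show ?thesis .
qed

text \<open>The restricted colourings form a countable set, so preimages of single colourings
  suffice, and these are boxes.\<close>

lemma measurable_restrict_colours:
  assumes f: "f \<in> measurable unif01 (count_space (UNIV :: nat set))"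
  shows "(\<lambda>x. \<lambda>i\<in>{..<n}. f (x i)) \<in> measurable (sample n) (count_space UNIV)"
proof -
  let ?F = "\<lambda>x :: nat \<Rightarrow> real. \<lambda>i\<in>{..<n}. f (x i)"
  let ?\<Omega> = "PiE {..<n} (\<lambda>_. UNIV :: nat set)"
  have "countable ?\<Omega>" by (intro countable_PiE) auto
  moreover have "?F -` {c} \<inter> space (sample n) \<in> sets (sample n)" if "c \<in> ?\<Omega>" for c
  proof -
    have "?F -` {c} \<inter> space (sample n) = PiE {..<n} (\<lambda>i. f -` {c i} \<inter> space unif01)"
      using that by (fastforce simp: space_PiM PiE_iff extensional_def fun_eq_iff restrict_def)
    then show ?thesis using measurable_sets[OF f] by (auto intro!: sets_PiM_I_finite)
  qed
  ultimately have "?F \<in> measurable (sample n) (count_space ?\<Omega>)"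
    by (subst measurable_count_space_eq_countable) auto
  then show ?thesis by (rule measurable_compose) simp
qed

text \<open>Both laws live on the countable set of extensional colourings and are compared point by
  point. The default \<open>undefined\<close> of \<open>Pi_pmf\<close> is the value that restriction
  assigns outside \<open>{..<n}\<close>.\<close>

lemma distr_sample_colouring:
  fixes p :: "nat pmf"
  assumes f: "f \<in> measurable unif01 (count_space UNIV)"
    and p: "\<And>k. measure unif01 {x\<in>{0..1}. f x = k} = pmf p k"
  shows "distr (sample n) (count_space UNIV) (\<lambda>x. \<lambda>i\<in>{..<n}. f (x i)) =
    measure_pmf (Pi_pmf {..<n} undefined (\<lambda>_. p))"
proof -
  interpret prob_space unif01 by (rule prob_space_unif01)
  interpret P: product_prob_space "\<lambda>_. unif01" "{..<n}" by unfold_locales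
  let ?F = "\<lambda>x :: nat \<Rightarrow> real. \<lambda>i\<in>{..<n}. f (x i)"
  let ?\<Omega> = "PiE {..<n} (\<lambda>_. UNIV :: nat set)"
  have count: "countable ?\<Omega>" by (intro countable_PiE) auto
  have single: "?F -` {c} \<inter> space (sample n) = PiE {..<n} (\<lambda>i. {x\<in>{0..1}. f x = c i})" if "c \<in> ?\<Omega>" for c
    using that by (fastforce simp: space_PiM PiE_iff extensional_def fun_eq_iff restrict_def)
  have set: "{x\<in>{0..1}. f x = k} \<in> sets unif01" for k
    using measurable_sets[OF f, of "{k}"] by (simp add: vimage_def Int_def conj_commute)
  note F = measurable_restrict_colours[OF f, of n]
  interpret D: prob_space "distr (sample n) (count_space UNIV) ?F"
    using F by (intro prob_space.prob_space_distr prob_space_sample)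
  show ?thesis
  proof (rule measure_eqI_countable_AE)
    show "AE c in distr (sample n) (count_space UNIV) ?F. c \<in> ?\<Omega>"
      using F by (subst AE_distr_iff) auto
    show "AE c in measure_pmf (Pi_pmf {..<n} undefined (\<lambda>_. p)). c \<in> ?\<Omega>"
      using set_Pi_pmf_subset[of "{..<n}" undefined "\<lambda>_. p"]
      by (auto simp: AE_measure_pmf_iff PiE_iff extensional_def)
    show "emeasure (distr (sample n) (count_space UNIV) ?F) {c} =
        emeasure (measure_pmf (Pi_pmf {..<n} undefined (\<lambda>_. p))) {c}" if c: "c \<in> ?\<Omega>" for c
    proof -
      have "emeasure (distr (sample n) (count_space UNIV) ?F) {c} =
          emeasure (sample n) (PiE {..<n} (\<lambda>i. {x\<in>{0..1}. f x = c i}))"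
        using F by (simp add: emeasure_distr single[OF c])
      also have "\<dots> = (\<Prod>i<n. emeasure unif01 {x\<in>{0..1}. f x = c i})"
        using set by (intro P.emeasure_PiM) auto
      also have "\<dots> = ennreal (\<Prod>i<n. pmf p (c i))"
        by (simp only: emeasure_eq_measure p prod_ennreal pmf_nonneg)
      also have "(\<Prod>i<n. pmf p (c i)) = pmf (Pi_pmf {..<n} undefined (\<lambda>_. p)) c"
        using c by (subst pmf_Pi') (auto simp: PiE_iff extensional_def)
      finally show ?thesis unfolding emeasure_pmf_single .
    qed
  qed (use count in simp_all)
qed

text \<open>The exceptional set \<open>N\<close> absorbs boundary points of the parts. Almost surely
  none of the finitely many sampled points falls into it, and then adjacency is equality of
  colours.\<close>

lemma W_random_graph_colour_classes:
  fixes p :: "nat pmf"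
  assumes W: "case_prod W \<in> borel_measurable (unif01 \<Otimes>\<^sub>M unif01)"
    and zero_one: "\<And>x y. W x y \<in> {0, 1}"
    and f [measurable]: "f \<in> measurable unif01 (count_space UNIV)"
    and p: "\<And>k. measure unif01 {x\<in>{0..1}. f x = k} = pmf p k"
    and N: "AE x in unif01. x \<notin> N"
    and W_iff: "\<And>x y. x \<in> {0..1} - N \<Longrightarrow> y \<in> {0..1} - N \<Longrightarrow> W x y = 1 \<longleftrightarrow> f x = f y"
  shows "W_random_graph n W =
    measure_pmf (map_pmf (\<lambda>c. graph_of_rel n (kernel_on n c)) (Pi_pmf {..<n} undefined (\<lambda>_. p)))"
proof -
  let ?F = "\<lambda>x :: nat \<Rightarrow> real. \<lambda>i\<in>{..<n}. f (x i)"
  have "AE x in sample n. \<forall>i\<in>{..<n}. x i \<notin> N"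
    using N prob_space_unif01 by (intro AE_finite_allI AE_PiM_component) auto
  then have AE: "AE x in sample n. graph_of_rel n {(i, j). W (x i) (x j) = 1} =
      graph_of_rel n {(i, j). f (x i) = f (x j)}"
  proof (rule AE_mp, intro AE_I2 impI graph_of_rel_cong)
    fix x i j assume x: "x \<in> space (sample n)" "\<forall>i\<in>{..<n}. x i \<notin> N" and "i < j" "j < n"
    then have "x i \<in> {0..1} - N" "x j \<in> {0..1} - N" by (auto simp: space_PiM PiE_iff)
    then show "(i, j) \<in> {(i, j). W (x i) (x j) = 1} \<longleftrightarrow> (i, j) \<in> {(i, j). f (x i) = f (x j)}"
      using W_iff by simp
  qed
  have f_nth [measurable]: "(\<lambda>x. f (x i)) \<in> measurable (sample n) (count_space UNIV)" if "i < n" for i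
    using that by (intro measurable_compose[OF sample_nth_measurable f])
  have "W_random_graph n W =
      distr (sample n) (count_space UNIV) (\<lambda>x. graph_of_rel n {(i, j). W (x i) (x j) = 1})"
    by (rule W_random_graph_zero_one[OF W zero_one])
  also have "\<dots> = distr (sample n) (count_space UNIV) (\<lambda>x. graph_of_rel n {(i, j). f (x i) = f (x j)})"
    using AE by (intro distr_cong_AE measurable_graph_of_rel pred_W_eq_1 W) auto
  also have "(\<lambda>x. graph_of_rel n {(i, j). f (x i) = f (x j)}) =
      (\<lambda>c. graph_of_rel n (kernel_on n c)) \<circ> ?F"
    unfolding comp_def by (intro ext graph_of_rel_cong) (auto simp: kernel_on_def)
  also have "distr (sample n) (count_space UNIV) \<dots> =
      distr (distr (sample n) (count_space UNIV) ?F) (count_space UNIV) (\<lambda>c. graph_of_rel n (kernel_on n c))"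
    by (rule distr_distr[symmetric]) (simp_all add: measurable_restrict_colours f)
  also have "\<dots> = measure_pmf (map_pmf (\<lambda>c. graph_of_rel n (kernel_on n c)) (Pi_pmf {..<n} undefined (\<lambda>_. p)))"
    unfolding distr_sample_colouring[OF f p] by (simp add: map_pmf_rep_eq)
  finally show ?thesis .
qed

lemma null_set_singleton_1: "{1} \<in> null_sets lborel"
  by (simp add: null_sets_def)

lemma borel_measurable_of_bool_eq:
  fixes f g :: "'c \<Rightarrow> nat"
  assumes "f \<in> measurable M (count_space UNIV)" "g \<in> measurable M (count_space UNIV)"
  shows "(\<lambda>x. of_bool (f x = g x) :: real) \<in> borel_measurable M"
proof -
  have [measurable]: "(\<lambda>x. real (f x)) \<in> borel_measurable M" "(\<lambda>x. real (g x)) \<in> borel_measurable M"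
    using assms by simp_all
  have "(\<lambda>x. if real (f x) = real (g x) then 1 else 0 :: real) \<in> borel_measurable M"
    by measurable
  then show ?thesis by (simp add: of_bool_def)
qed

text \<open>Applied with \<open>c = -1\<close> to mirror a part and with \<open>c = b i\<close> to
  parametrise a segment.\<close>

lemma emeasure_lborel_affine_vimage:
  fixes c t :: real
  assumes "c \<noteq> 0" and D [measurable]: "D \<in> sets borel"
  shows "emeasure lborel D = \<bar>c\<bar> * emeasure lborel {x. t + c * x \<in> D}"
proof -
  have "emeasure lborel D = (\<integral>\<^sup>+x. indicator D x \<partial>lborel)" by simp
  also have "\<dots> = \<bar>c\<bar> * (\<integral>\<^sup>+x. indicator D (t + c * x) \<partial>lborel)"
    using assms by (intro nn_integral_real_affine) auto
  also have "(\<lambda>x. indicator D (t + c * x) :: ennreal) = indicator {x. t + c * x \<in> D}"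
    by (auto simp: indicator_def fun_eq_iff)
  also have "(\<integral>\<^sup>+x. indicator {x. t + c * x \<in> D} x \<partial>lborel) = emeasure lborel {x. t + c * x \<in> D}"
    by (intro nn_integral_indicator) measurable
  finally show ?thesis .
qed

section \<open>Graphons and permutons of a partition of the unit interval\<close>

text \<open>Left endpoint of part \<open>i\<close>, parts being counted from 0; the right endpoint
  is \<open>cum b (Suc i)\<close>.\<close>

definition cum :: "(nat \<Rightarrow> real) \<Rightarrow> nat \<Rightarrow> real" where
  "cum b i = (\<Sum>k<i. b k)"

text \<open>Only meaningful for \<open>x\<close> below the supremum of \<open>cum b\<close>; at \<open>x = 1\<close>, a null set, the
  value is arbitrary.\<close>

definition colour :: "(nat \<Rightarrow> real) \<Rightarrow> real \<Rightarrow> nat" where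
  "colour b x = (LEAST i. x < cum b (Suc i))"

text \<open>The clique graphon on half-open parts of arbitrary sizes. Unlike with closed parts,
  adjacency is an exact equivalence relation, without exceptional points.\<close>

definition same_colour_graphon :: "(nat \<Rightarrow> real) \<Rightarrow> real \<Rightarrow> real \<Rightarrow> real" where
  "same_colour_graphon b x y = of_bool (colour b x = colour b y)"

text \<open>Meant both for the geometric sizes and for their modification, of which just positivity
  and total mass are known.\<close>

locale part_weights =
  fixes b :: "nat \<Rightarrow> real"
  assumes pos: "0 < b i" and sums: "b sums 1"
begin

lemma strict_mono_cum: "strict_mono (cum b)"
  by (simp add: strict_mono_Suc_iff cum_def pos)

lemma cum_less_1: "cum b i < 1"
proof -
  have "cum b i < cum b (Suc i)" using strict_mono_cum by (simp add: strict_mono_Suc_iff)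
  also have "\<dots> \<le> 1"
    unfolding cum_def using sum_le_suminf[of b "{..<Suc i}"] sums pos
    by (simp add: sums_iff less_imp_le)
  finally show ?thesis .
qed

lemma cum_nonneg: "0 \<le> cum b i"
  by (simp add: cum_def sum_nonneg less_imp_le pos)

lemma colourI: "cum b i \<le> x \<Longrightarrow> x < cum b (Suc i) \<Longrightarrow> colour b x = i"
  unfolding colour_def
proof (rule Least_equality)
  fix j assume "cum b i \<le> x" "x < cum b (Suc j)"
  then have "cum b i < cum b (Suc j)" by linarith
  then show "i \<le> j" using strict_mono_cum by (simp add: strict_mono_less)
qed

text \<open>The partial sums tend to 1, so every \<open>x\<close> below 1 is eventually exceeded;
  minimality of the first such index gives the lower bound.\<close>

lemma colour_bounds:
  assumes "0 \<le> x" "x < 1"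
  shows "cum b (colour b x) \<le> x" "x < cum b (Suc (colour b x))"
proof -
  have "cum b \<longlonglongrightarrow> 1" using sums by (simp add: sums_def cum_def[abs_def])
  then have "\<forall>\<^sub>F i in sequentially. x < cum b i" using assms(2) by (rule order_tendstoD)
  then obtain i where "x < cum b i" by (auto simp: eventually_sequentially)
  also have "cum b i \<le> cum b (Suc i)" using strict_mono_cum by (simp add: strict_mono_less_eq)
  finally have ex: "x < cum b (Suc i)" .
  show upper: "x < cum b (Suc (colour b x))" unfolding colour_def using ex by (rule LeastI)
  show "cum b (colour b x) \<le> x"
  proof (cases "colour b x")
    case 0
    then show ?thesis using assms(1) by (simp add: cum_def)
  next
    case (Suc j)
    then have "\<not> x < cum b (Suc j)" unfolding colour_def by (intro not_less_Least) simp
    then show ?thesis using Suc by simp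
  qed
qed

lemma colour_eq_iff:
  assumes "0 \<le> x" "x < 1"
  shows "colour b x = i \<longleftrightarrow> cum b i \<le> x \<and> x < cum b (Suc i)"
  by (metis colourI colour_bounds[OF assms])

lemma measurable_colour [measurable]: "colour b \<in> measurable borel (count_space UNIV)"
  unfolding colour_def by measurable

lemma measurable_colour_unif01: "colour b \<in> measurable unif01 (count_space UNIV)"
  by (rule measurable_compose[OF _ measurable_colour]) (rule measurable_from_unif01, simp)

text \<open>The half-open parts are disjoint and cover the unit interval up to the point 1, a null
  set. Measures can thus be compared one part at a time.\<close>

lemma emeasure_eq_suminf_parts:
  assumes "D \<subseteq> {0..1}" and D [measurable]: "D \<in> sets borel"
  shows "emeasure lborel D = (\<Sum>i. emeasure lborel (D \<inter> {cum b i..<cum b (Suc i)}))"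
proof -
  have "emeasure lborel D = emeasure lborel (D - {1})"
    using null_set_singleton_1 by (subst emeasure_Diff_null_set) auto
  also have "D - {1} = (\<Union>i. D \<inter> {cum b i..<cum b (Suc i)})"
  proof (rule set_eqI)
    fix x
    have "x \<in> {cum b (colour b x)..<cum b (Suc (colour b x))}" if "x \<in> D - {1}"
      using colour_bounds[of x] that assms(1) by (auto simp: subset_iff order_le_less)
    moreover have "x \<noteq> 1" if "x \<in> {cum b i..<cum b (Suc i)}" for i
      using that cum_less_1[of "Suc i"] by auto
    ultimately show "x \<in> D - {1} \<longleftrightarrow> x \<in> (\<Union>i. D \<inter> {cum b i..<cum b (Suc i)})" by blast
  qed
  also have "emeasure lborel \<dots> = (\<Sum>i. emeasure lborel (D \<inter> {cum b i..<cum b (Suc i)}))"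
  proof (rule suminf_emeasure[symmetric])
    have "i = j" if "x \<in> {cum b i..<cum b (Suc i)}" "x \<in> {cum b j..<cum b (Suc j)}" for i j x
      using that colourI[of i x] colourI[of j x] by auto
    then show "disjoint_family (\<lambda>i. D \<inter> {cum b i..<cum b (Suc i)})"
      unfolding disjoint_family_on_def by blast
  qed auto
  finally show ?thesis .
qed

lemma measure_colour: "measure unif01 {x\<in>{0..1}. colour b x = i} = b i"
proof -
  let ?S = "{x\<in>{0..1}. colour b x = i}"
  have meas: "?S \<in> sets borel" by measurable
  have "emeasure unif01 ?S = emeasure lborel ?S"
    by (rule emeasure_unif01) auto
  also have "\<dots> = emeasure lborel (?S - {1})"
    using null_set_singleton_1 meas by (intro emeasure_Diff_null_set[symmetric]) auto
  also have "?S - {1} = {cum b i..<cum b (Suc i)}"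
    using colour_eq_iff[of _ i] cum_less_1[of "Suc i"] cum_nonneg[of i] by fastforce
  also have "emeasure lborel \<dots> = ennreal (b i)"
    using strict_mono_cum by (simp add: cum_def less_imp_le[OF pos])
  finally show ?thesis by (simp add: measure_def less_imp_le[OF pos])
qed

lemma ex_part_pmf: "\<exists>p. \<forall>i. pmf p i = b i"
proof -
  have "(\<integral>\<^sup>+ i. ennreal (b i) \<partial>count_space UNIV) = (\<Sum>i. ennreal (b i))"
    by (rule nn_integral_count_space_nat)
  also have "\<dots> = ennreal 1"
    by (rule suminf_ennreal_eq[OF less_imp_le[OF pos] sums])
  finally show ?thesis
    by (intro exI[of _ "embed_pmf b"] allI pmf_embed_pmf less_imp_le[OF pos]) simp
qed

lemma measurable_same_colour_graphon:
  "case_prod (same_colour_graphon b) \<in> borel_measurable (unif01 \<Otimes>\<^sub>M unif01)"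
proof -
  have "(\<lambda>q. colour b (fst q)) \<in> measurable (unif01 \<Otimes>\<^sub>M unif01) (count_space UNIV)"
    "(\<lambda>q. colour b (snd q)) \<in> measurable (unif01 \<Otimes>\<^sub>M unif01) (count_space UNIV)"
    by (rule measurable_compose[OF _ measurable_colour_unif01], simp)+
  then show ?thesis
    unfolding same_colour_graphon_def case_prod_unfold by (rule borel_measurable_of_bool_eq)
qed

lemma graphon_same_colour: "graphon (same_colour_graphon b)"
  using measurable_same_colour_graphon by (auto simp: graphon_def same_colour_graphon_def)

lemma W_random_graph_same_colour:
  assumes "\<And>i. pmf p i = b i"
  shows "W_random_graph n (same_colour_graphon b) =
    measure_pmf (map_pmf (\<lambda>c. graph_of_rel n (kernel_on n c)) (Pi_pmf {..<n} undefined (\<lambda>_. p)))"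
proof (rule W_random_graph_colour_classes)
  show "colour b \<in> measurable unif01 (count_space UNIV)" by (rule measurable_colour_unif01)
  show "measure unif01 {x\<in>{0..1}. colour b x = k} = pmf p k" for k
    using measure_colour assms by simp
  show "AE x in unif01. x \<notin> {}" by simp
qed (auto simp: measurable_same_colour_graphon same_colour_graphon_def)

text \<open>Reverses each part in its midpoint, so that the antidiagonal segments of the permuton form
  its graph; the value at 1 only keeps it inside the unit interval.\<close>

definition reflect :: "real \<Rightarrow> real" where
  "reflect x = (if x < 1 then cum b (colour b x) + cum b (Suc (colour b x)) - x else 1)"

lemma reflect_eq: "cum b i \<le> x \<Longrightarrow> x < cum b (Suc i) \<Longrightarrow> reflect x = cum b i + cum b (Suc i) - x"
  using cum_less_1[of "Suc i"] colourI[of i x] by (simp add: reflect_def)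

lemma reflect_bounds:
  assumes "0 \<le> x" "x < 1"
  shows "cum b (colour b x) < reflect x" "reflect x \<le> cum b (Suc (colour b x))"
  using colour_bounds[OF assms] assms by (simp_all add: reflect_def)

lemma reflect_in_unit: "x \<in> {0..1} \<Longrightarrow> reflect x \<in> {0..1}"
  using reflect_bounds[of x] cum_nonneg[of "colour b x"] cum_less_1[of "Suc (colour b x)"]
  by (cases "x < 1") (auto simp: reflect_def)

lemma measurable_reflect: "reflect \<in> measurable unif01 unif01"
proof (rule measurable_unif01I)
  have "reflect \<in> borel_measurable borel" unfolding reflect_def[abs_def] by measurable
  then show "reflect \<in> borel_measurable unif01"
    by (rule measurable_compose[rotated]) (rule measurable_from_unif01, simp)
qed (use reflect_in_unit in auto)

text \<open>On each part the map is a reflection, which preserves Lebesgue measure and the part up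
  to its endpoints.\<close>

lemma distr_reflect: "distr unif01 unif01 reflect = unif01"
proof (rule measure_eqI)
  fix A assume "A \<in> sets (distr unif01 unif01 reflect)"
  then have A: "A \<in> sets unif01" by simp
  then have A' [measurable]: "A \<in> sets borel" and sub: "A \<subseteq> {0..1}" by (auto simp: sets_unif01_iff)
  let ?D = "reflect -` A \<inter> {0..1}"
  have D: "?D \<in> sets unif01" using measurable_sets[OF measurable_reflect A] by simp
  then have D' [measurable]: "?D \<in> sets borel" by (simp add: sets_unif01_iff)
  have "emeasure lborel (?D \<inter> {cum b i..<cum b (Suc i)}) = emeasure lborel (A \<inter> {cum b i..<cum b (Suc i)})" for i
  proof -
    let ?z = "cum b i" and ?z' = "cum b (Suc i)"
    have lt: "?z < ?z'" using strict_mono_cum by (simp add: strict_mono_Suc_iff)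
    have "?D \<inter> {?z..<?z'} = {x. (?z + ?z') + (-1) * x \<in> A \<inter> {?z<..?z'}}"
      using reflect_eq[of i] cum_less_1[of "Suc i"] cum_nonneg[of i] by auto
    then have "emeasure lborel (?D \<inter> {?z..<?z'}) = emeasure lborel (A \<inter> {?z<..?z'})"
      using emeasure_lborel_affine_vimage[of "-1" "A \<inter> {?z<..?z'}" "?z + ?z'"] by simp
    \<comment> \<open>The reflection turns the part closed on the left into one closed on the right;
      exchanging the two endpoints costs only null sets.\<close>
    also have "\<dots> = emeasure lborel (A \<inter> {?z<..?z'} - {?z'})"
      by (rule emeasure_Diff_null_set[symmetric]) (auto simp: null_sets_def)
    also have "A \<inter> {?z<..?z'} - {?z'} = A \<inter> {?z..<?z'} - {?z}" by auto
    also have "emeasure lborel \<dots> = emeasure lborel (A \<inter> {?z..<?z'})"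
      by (rule emeasure_Diff_null_set) (auto simp: null_sets_def)
    finally show ?thesis .
  qed
  then have "emeasure lborel ?D = emeasure lborel A"
    by (subst (1 2) emeasure_eq_suminf_parts) (use sub in auto)
  then show "emeasure (distr unif01 unif01 reflect) A = emeasure unif01 A"
    using A sub measurable_reflect by (simp add: emeasure_distr emeasure_unif01)
qed simp

definition reflection_permuton :: "(real \<times> real) measure" where
  "reflection_permuton = distr unif01 (unif01 \<Otimes>\<^sub>M unif01) (\<lambda>x. (x, reflect x))"

lemma measurable_graph_reflect: "(\<lambda>x. (x, reflect x)) \<in> measurable unif01 (unif01 \<Otimes>\<^sub>M unif01)"
  by (intro measurable_Pair measurable_ident_sets measurable_reflect refl)

lemma permuton_reflection_permuton: "permuton reflection_permuton"
  unfolding permuton_def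
proof (intro conjI)
  show "prob_space reflection_permuton"
    unfolding reflection_permuton_def
    by (intro prob_space.prob_space_distr prob_space_unif01 measurable_graph_reflect)
  show "distr reflection_permuton unif01 fst = unif01"
    unfolding reflection_permuton_def
    by (subst distr_distr[OF measurable_fst measurable_graph_reflect]) (simp add: comp_def distr_id2)
  show "distr reflection_permuton unif01 snd = unif01"
    unfolding reflection_permuton_def
    by (subst distr_distr[OF measurable_snd measurable_graph_reflect]) (simp add: comp_def distr_reflect)
qed (simp add: reflection_permuton_def)

lemma measurable_linepath_unif01:
  assumes "0 \<le> z" "z < z'" "z' \<le> 1"
  shows "linepath (z, z') (z', z) \<in> measurable unif01 (unif01 \<Otimes>\<^sub>M unif01)"
proof -
  have eq: "linepath (z, z') (z', z) = (\<lambda>t. (z + (z' - z) * t, z' + (z - z') * t))"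
    by (auto simp: linepath_def fun_eq_iff algebra_simps)
  have id: "(\<lambda>x. x) \<in> borel_measurable unif01" by (rule measurable_from_unif01) simp
  have "z + (z' - z) * t \<in> {0..1} \<and> z' + (z - z') * t \<in> {0..1}" if "t \<in> {0..1}" for t
  proof -
    have "0 \<le> (z' - z) * t" "(z' - z) * t \<le> z' - z"
      using that assms by (auto intro!: mult_left_le)
    then show ?thesis using assms by (auto simp: algebra_simps)
  qed
  then show ?thesis
    unfolding eq using id by (intro measurable_Pair measurable_unif01I borel_measurable_add
        borel_measurable_times borel_measurable_const) auto
qed

text \<open>Scaling by \<open>b i\<close> and shifting by \<open>cum b i\<close> carries the
  parameter of the segment to the first coordinate, after which the segment is the graph of
  \<open>reflect\<close> over the part. The weight \<open>b i\<close> is the Jacobian.\<close>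

lemma emeasure_uniform_antidiagonal:
  assumes A: "A \<in> sets (unif01 \<Otimes>\<^sub>M unif01)"
  shows "ennreal (b i) * emeasure (uniform_antidiagonal (cum b i) (cum b (Suc i))) A =
    emeasure lborel ((\<lambda>x. (x, reflect x)) -` A \<inter> {0..1} \<inter> {cum b i..<cum b (Suc i)})"
proof -
  let ?z = "cum b i" and ?z' = "cum b (Suc i)"
  have bi: "?z' - ?z = b i" by (simp add: cum_def)
  have lt: "?z < ?z'" using strict_mono_cum by (simp add: strict_mono_Suc_iff)
  let ?l = "linepath (?z, ?z') (?z', ?z)"
  have l: "?l \<in> measurable unif01 (unif01 \<Otimes>\<^sub>M unif01)"
    using cum_nonneg lt cum_less_1[of "Suc i"] by (intro measurable_linepath_unif01) auto
  have l_eq: "?l t = (?z + b i * t, ?z + ?z' - (?z + b i * t))" for t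
    by (simp add: linepath_def bi[symmetric] algebra_simps)
  have B: "?l -` A \<inter> {0..1} \<in> sets unif01" using measurable_sets[OF l A] by simp
  then have B' [measurable]: "?l -` A \<inter> {0..1} \<in> sets borel" by (simp add: sets_unif01_iff)
  let ?D = "(\<lambda>x. (x, reflect x)) -` A \<inter> {0..1} \<inter> {?z..<?z'}"
  have "(\<lambda>x. (x, reflect x)) -` A \<inter> {0..1} \<in> sets unif01"
    using measurable_sets[OF measurable_graph_reflect A] by simp
  then have D [measurable]: "?D \<in> sets borel" by (simp add: sets_unif01_iff)
  \<comment> \<open>The parameter 1 is removed because its image \<open>?z'\<close> already belongs
    to the next part.\<close>
  have "{t. ?z + b i * t \<in> ?D} = ?l -` A \<inter> {0..1} - {1}"
  proof (rule set_eqI)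
    fix t
    have "?z \<le> ?z + b i * t \<longleftrightarrow> 0 \<le> t" using pos[of i] by (simp add: zero_le_mult_iff)
    moreover have "?z + b i * t < ?z' \<longleftrightarrow> t < 1" using pos[of i] bi by (simp add: algebra_simps)
    ultimately show "t \<in> {t. ?z + b i * t \<in> ?D} \<longleftrightarrow> t \<in> ?l -` A \<inter> {0..1} - {1}"
      using cum_nonneg[of i] cum_less_1[of "Suc i"] reflect_eq[of i "?z + b i * t"]
      by (auto simp: l_eq)
  qed
  then have "emeasure lborel ?D = ennreal (b i) * emeasure lborel (?l -` A \<inter> {0..1} - {1})"
    using emeasure_lborel_affine_vimage[of "b i" ?D ?z] pos[of i] by simp
  also have "emeasure lborel (?l -` A \<inter> {0..1} - {1}) = emeasure lborel (?l -` A \<inter> {0..1})"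
    using null_set_singleton_1 by (rule emeasure_Diff_null_set) simp
  also have "\<dots> = emeasure (uniform_antidiagonal ?z ?z') A"
    unfolding uniform_antidiagonal_def using A l by (simp add: emeasure_distr emeasure_unif01)
  finally show ?thesis by simp
qed

text \<open>Cutting the preimage of a set along the parts turns its measure into the weighted sum of
  segment measures. Countable additivity of that sum is inherited from the image measure, with which
  it agrees on the sigma-algebra.\<close>

lemma reflection_permuton_eq:
  "reflection_permuton = measure_of ({0..1} \<times> {0..1}) (sets (unif01 \<Otimes>\<^sub>M unif01))
    (\<lambda>A. \<Sum>i. ennreal (b i) * emeasure (uniform_antidiagonal (cum b i) (cum b (Suc i))) A)"
proof -
  let ?\<mu> = "\<lambda>A. \<Sum>i. ennreal (b i) * emeasure (uniform_antidiagonal (cum b i) (cum b (Suc i))) A"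
  have "emeasure reflection_permuton A = ?\<mu> A" if A: "A \<in> sets (unif01 \<Otimes>\<^sub>M unif01)" for A
  proof -
    let ?D = "(\<lambda>x. (x, reflect x)) -` A \<inter> {0..1}"
    have "?D \<in> sets unif01" using measurable_sets[OF measurable_graph_reflect A] by simp
    then have D: "?D \<in> sets borel" "?D \<subseteq> {0..1}" by (auto simp: sets_unif01_iff)
    have "emeasure reflection_permuton A = emeasure lborel ?D"
      unfolding reflection_permuton_def using A measurable_graph_reflect D(2)
      by (simp add: emeasure_distr emeasure_unif01)
    also have "\<dots> = ?\<mu> A"
      by (simp add: emeasure_eq_suminf_parts[OF D(2,1)] emeasure_uniform_antidiagonal[OF A])
    finally show ?thesis .
  qed
  moreover have "sets (unif01 \<Otimes>\<^sub>M unif01) \<subseteq> Pow ({0..1} \<times> {0..1})"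
    "sigma_sets ({0..1} \<times> {0..1}) (sets (unif01 \<Otimes>\<^sub>M unif01)) = sets (unif01 \<Otimes>\<^sub>M unif01)"
    using sets.space_closed[of "unif01 \<Otimes>\<^sub>M unif01"] sets.sigma_sets_eq[of "unif01 \<Otimes>\<^sub>M unif01"]
    by (simp_all add: space_pair_measure)
  ultimately have "measure_of ({0..1} \<times> {0..1}) (sets (unif01 \<Otimes>\<^sub>M unif01)) (emeasure reflection_permuton) =
      measure_of ({0..1} \<times> {0..1}) (sets (unif01 \<Otimes>\<^sub>M unif01)) ?\<mu>"
    by (intro measure_of_eq) simp_all
  moreover have "measure_of ({0..1} \<times> {0..1}) (sets (unif01 \<Otimes>\<^sub>M unif01)) (emeasure reflection_permuton) =
      reflection_permuton"
    using measure_of_of_measure[of reflection_permuton]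
    by (simp add: reflection_permuton_def space_pair_measure)
  ultimately show ?thesis by simp
qed

end

section \<open>Inversion graphs\<close>

lemma graph_iso_refl: "G \<cong>\<^sub>g G"
  unfolding graph_iso_def by (intro exI[of _ id]) auto

lemma graph_iso_sym:
  assumes "G \<cong>\<^sub>g H"
  shows "H \<cong>\<^sub>g G"
proof -
  obtain f where f: "bij_betw f (verts G) (verts H)"
    "\<And>u v. u \<in> verts G \<Longrightarrow> v \<in> verts G \<Longrightarrow> {u, v} \<in> edges G \<longleftrightarrow> {f u, f v} \<in> edges H"
    using assms unfolding graph_iso_def by blast
  let ?g = "the_inv_into (verts G) f"
  have g: "bij_betw ?g (verts H) (verts G)" using f(1) by (rule bij_betw_the_inv_into)
  have "f (?g u) = u" "?g u \<in> verts G" if "u \<in> verts H" for u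
    using f(1) g that by (auto simp: f_the_inv_into_f_bij_betw bij_betw_apply)
  then have "{u, v} \<in> edges H \<longleftrightarrow> {?g u, ?g v} \<in> edges G" if "u \<in> verts H" "v \<in> verts H" for u v
    using f(2)[of "?g u" "?g v"] that by simp
  then show ?thesis using g unfolding graph_iso_def by blast
qed

lemma graph_iso_trans:
  assumes "G \<cong>\<^sub>g H" "H \<cong>\<^sub>g K"
  shows "G \<cong>\<^sub>g K"
proof -
  obtain f where f: "bij_betw f (verts G) (verts H)"
    "\<And>u v. u \<in> verts G \<Longrightarrow> v \<in> verts G \<Longrightarrow> {u, v} \<in> edges G \<longleftrightarrow> {f u, f v} \<in> edges H"
    using assms(1) unfolding graph_iso_def by blast
  obtain g where g: "bij_betw g (verts H) (verts K)"
    "\<And>u v. u \<in> verts H \<Longrightarrow> v \<in> verts H \<Longrightarrow> {u, v} \<in> edges H \<longleftrightarrow> {g u, g v} \<in> edges K"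
    using assms(2) unfolding graph_iso_def by blast
  have "bij_betw (g \<circ> f) (verts G) (verts K)" using f(1) g(1) by (rule bij_betw_trans)
  moreover have "{u, v} \<in> edges G \<longleftrightarrow> {(g \<circ> f) u, (g \<circ> f) v} \<in> edges K"
    if "u \<in> verts G" "v \<in> verts G" for u v
    using f(2)[OF that] g(2)[of "f u" "f v"] bij_betw_apply[OF f(1)] that by simp
  ultimately show ?thesis unfolding graph_iso_def by blast
qed

lemma graph_iso_cong_left: "G \<cong>\<^sub>g G' \<Longrightarrow> G \<cong>\<^sub>g H \<longleftrightarrow> G' \<cong>\<^sub>g H"
  by (meson graph_iso_sym graph_iso_trans)

lemma edge_graph_of_rel: "i < j \<Longrightarrow> {i, j} \<in> edges (graph_of_rel n R) \<longleftrightarrow> j < n \<and> (i, j) \<in> R"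
  by (auto simp: graph_of_rel_def doubleton_eq_iff)

text \<open>\<open>graph_iso\<close> also tests \<open>u = v\<close>, where the pair degenerates to
  a singleton; this settles that case.\<close>

lemma loop_graph_of_rel: "{i, i} \<notin> edges (graph_of_rel n R)"
  by (auto simp: graph_of_rel_def)

lemma verts_graph_of_rel [simp]: "verts (graph_of_rel n R) = {..<n}"
  by (simp add: graph_of_rel_def)

lemma finite_simple_graph_of_rel: "finite_simple_graph (graph_of_rel n R)"
  by (auto simp: finite_simple_graph_def graph_of_rel_def card_insert_if)

lemma edge_inversion_graph: "i < j \<Longrightarrow> {i, j} \<in> edges (inversion_graph n \<pi>) \<longleftrightarrow> j < n \<and> \<pi> j < \<pi> i"
  by (auto simp: inversion_graph_def doubleton_eq_iff)

lemma loop_inversion_graph: "{i, i} \<notin> edges (inversion_graph n \<pi>)"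
  by (auto simp: inversion_graph_def)

text \<open>The predecessors of \<open>i\<close> in the tie-broken order are predecessors of
  \<open>j\<close>, and \<open>i\<close> itself is a predecessor of \<open>j\<close> but not of
  \<open>i\<close>.\<close>

lemma rank_of_less:
  assumes "i < n" "f i < f j \<or> f i = f j \<and> i < j"
  shows "rank_of n f i < rank_of n f j"
  unfolding rank_of_def
proof (rule psubset_card_mono)
  show "{k. k < n \<and> (f k < f i \<or> f k = f i \<and> k < i)} \<subset> {k. k < n \<and> (f k < f j \<or> f k = f j \<and> k < j)}"
  proof (rule psubsetI)
    show "{k. k < n \<and> (f k < f i \<or> f k = f i \<and> k < i)} \<subseteq> {k. k < n \<and> (f k < f j \<or> f k = f j \<and> k < j)}"
      using assms(2) by auto
    show "{k. k < n \<and> (f k < f i \<or> f k = f i \<and> k < i)} \<noteq> {k. k < n \<and> (f k < f j \<or> f k = f j \<and> k < j)}"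
      using assms by blast
  qed
qed simp

lemma rank_of_less_iff:
  assumes "i < n" "j < n"
  shows "rank_of n f i < rank_of n f j \<longleftrightarrow> f i < f j \<or> f i = f j \<and> i < j"
proof
  assume less: "rank_of n f i < rank_of n f j"
  show "f i < f j \<or> f i = f j \<and> i < j"
  proof (rule ccontr)
    assume "\<not> (f i < f j \<or> f i = f j \<and> i < j)"
    then have "i = j \<or> f j < f i \<or> f j = f i \<and> j < i" by auto
    then show False using less rank_of_less[OF assms(2), of f i] by auto
  qed
qed (use assms rank_of_less in blast)

lemma bij_betw_rank_of: "bij_betw (rank_of n f) {..<n} {..<n}"
proof -
  have inj: "inj_on (rank_of n f) {..<n}"
  proof (rule inj_onI)
    fix i j assume ij: "i \<in> {..<n}" "j \<in> {..<n}" "rank_of n f i = rank_of n f j"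
    then have "\<not> (f i < f j \<or> f i = f j \<and> i < j)" "\<not> (f j < f i \<or> f j = f i \<and> j < i)"
      using rank_of_less_iff[of i n j f] rank_of_less_iff[of j n i f] by auto
    then show "i = j" by auto
  qed
  have "rank_of n f i < n" if "i < n" for i
  proof -
    have "rank_of n f i < card {..<n}"
      unfolding rank_of_def using that by (intro psubset_card_mono) auto
    then show ?thesis by simp
  qed
  then show ?thesis
    using inj endo_inj_surj[OF finite_lessThan _ inj] by (auto simp: bij_betw_def)
qed

lemma perm_of_points_rank:
  assumes "i < n"
  shows "perm_of_points n p (rank_of n (\<lambda>i. fst (p i)) i) = rank_of n (\<lambda>i. snd (p i)) i"
proof -
  have bij: "bij_betw (rank_of n (\<lambda>i. fst (p i))) {..<n} {..<n}" by (rule bij_betw_rank_of)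
  have "(THE k. k < n \<and> rank_of n (\<lambda>i. fst (p i)) k = rank_of n (\<lambda>i. fst (p i)) i) = i"
    using assms bij by (intro the_equality) (auto simp: bij_betw_def inj_on_def)
  moreover have "rank_of n (\<lambda>i. fst (p i)) i < n" using bij_betw_apply[OF bij, of i] assms by simp
  ultimately show ?thesis by (simp add: perm_of_points_def)
qed

text \<open>The isomorphism renames each point by its \<open>x\<close>-rank. Without ties, ranks are
  ordered as the coordinates are, so an inversion is a pair whose two coordinate differences have
  opposite signs.\<close>

lemma inversion_graph_of_points:
  assumes inj: "inj_on (\<lambda>i. fst (p i)) {..<n}" "inj_on (\<lambda>i. snd (p i)) {..<n}"
  shows "graph_of_rel n {(i, j). (fst (p i) - fst (p j)) * (snd (p i) - snd (p j)) < 0} \<cong>\<^sub>g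
    inversion_graph n (perm_of_points n p)"
proof -
  let ?x = "\<lambda>i. fst (p i)" and ?y = "\<lambda>i. snd (p i)"
  let ?R = "{(i, j). (?x i - ?x j) * (?y i - ?y j) < 0}"
  let ?G = "graph_of_rel n ?R" and ?H = "inversion_graph n (perm_of_points n p)"
  let ?r = "rank_of n ?x"
  have bij: "bij_betw ?r {..<n} {..<n}" by (rule bij_betw_rank_of)
  have r_less: "?r i < ?r j \<longleftrightarrow> ?x i < ?x j" if "i < n" "j < n" "i \<noteq> j" for i j
    using rank_of_less_iff[of i n j ?x] that inj_onD[OF inj(1), of i j] by auto
  have y_less: "rank_of n ?y i < rank_of n ?y j \<longleftrightarrow> ?y i < ?y j" if "i < n" "j < n" "i \<noteq> j" for i j
    using rank_of_less_iff[of i n j ?y] that inj_onD[OF inj(2), of i j] by auto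
  have H: "{?r i, ?r j} \<in> edges ?H \<longleftrightarrow> ?y j < ?y i" if "i < n" "j < n" "?x i < ?x j" for i j
  proof -
    have "i \<noteq> j" using that(3) by auto
    then have "?r i < ?r j" using r_less that by simp
    then show ?thesis
      using edge_inversion_graph[of "?r i" "?r j"] bij_betw_apply[OF bij, of j] that \<open>i \<noteq> j\<close> y_less[of j i]
      by (simp add: perm_of_points_rank)
  qed
  have main: "{i, j} \<in> edges ?G \<longleftrightarrow> {?r i, ?r j} \<in> edges ?H" if "i < j" "j < n" for i j
  proof -
    have "?x i \<noteq> ?x j" using inj_onD[OF inj(1), of i j] that by auto
    then consider "?x i < ?x j" | "?x j < ?x i" by linarith
    then show ?thesis
    proof cases
      case 1
      then show ?thesis
        using H[of i j] that by (simp add: edge_graph_of_rel mult_less_0_iff)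
    next
      case 2
      then show ?thesis
        using H[of j i] that by (simp add: edge_graph_of_rel mult_less_0_iff insert_commute)
    qed
  qed
  have "{i, j} \<in> edges ?G \<longleftrightarrow> {?r i, ?r j} \<in> edges ?H" if "i < n" "j < n" for i j
  proof -
    consider "i < j" | "i = j" | "j < i" by linarith
    then show ?thesis
      using main[of i j] main[of j i] that loop_graph_of_rel[of i n ?R]
        loop_inversion_graph[of "?r i" n "perm_of_points n p"]
      by cases (simp_all add: insert_commute)
  qed
  moreover have "bij_betw ?r (verts ?G) (verts ?H)" using bij by (simp add: inversion_graph_def)
  ultimately show ?thesis unfolding graph_iso_def by auto
qed

lemma pred_less_or_tie:
  fixes f g :: "'a \<Rightarrow> real"
  assumes [measurable]: "f \<in> borel_measurable M" "g \<in> borel_measurable M"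
  shows "Measurable.pred M (\<lambda>x. f x < g x \<or> f x = g x \<and> tie)"
  by measurable

text \<open>The permutation is a function of finitely many coordinate comparisons. They are
  collected as triples \<open>(i, j, c)\<close>, where \<open>c\<close> chooses the coordinate, and
  \<open>perm\<close> rebuilds the permutation from that finite set.\<close>

lemma measurable_perm_of_points:
  "perm_of_points n \<in> measurable (\<Pi>\<^sub>M i\<in>{..<n}. unif01 \<Otimes>\<^sub>M unif01) (count_space UNIV)"
proof -
  let ?M = "\<Pi>\<^sub>M i\<in>{..<n}. unif01 \<Otimes>\<^sub>M unif01"
  define before where "before i j c p \<longleftrightarrow> (if c then fst (p j) < fst (p i) \<or> fst (p j) = fst (p i) \<and> j < i
      else snd (p j) < snd (p i) \<or> snd (p j) = snd (p i) \<and> j < i)"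
    for i j c and p :: "nat \<Rightarrow> real \<times> real"
  define I where "I = {..<n} \<times> {..<n} \<times> (UNIV :: bool set)"
  define rel where "rel p = {q\<in>I. case q of (i, j, c) \<Rightarrow> before i j c p}" for p
  define rank where "rank R c i = card {j. j < n \<and> (i, j, c) \<in> R}" for R :: "(nat \<times> nat \<times> bool) set" and c i
  define perm where "perm R r = (if r < n then rank R False (THE i. i < n \<and> rank R True i = r) else r)" for R r
  have "(\<lambda>p. perm (rel p)) \<in> measurable ?M (count_space UNIV)"
    unfolding rel_def
  proof (rule measurable_finite_relation)
    show "finite I" by (simp add: I_def)
    fix q assume "q \<in> I"
    then obtain i j c where q: "q = (i, j, c)" and ij: "i < n" "j < n" by (auto simp: I_def)
    have comp: "(\<lambda>p. p k) \<in> measurable ?M (unif01 \<Otimes>\<^sub>M unif01)" if "k < n" for k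
      using that by (intro measurable_component_singleton) simp
    have fst: "(\<lambda>p. fst (p k)) \<in> borel_measurable ?M" if "k < n" for k
      using measurable_compose[OF comp[OF that] measurable_fst] by (rule measurable_from_unif01)
    have snd: "(\<lambda>p. snd (p k)) \<in> borel_measurable ?M" if "k < n" for k
      using measurable_compose[OF comp[OF that] measurable_snd] by (rule measurable_from_unif01)
    show "Measurable.pred ?M (\<lambda>p. case q of (i, j, c) \<Rightarrow> before i j c p)"
      using pred_less_or_tie[OF fst[OF ij(2)] fst[OF ij(1)], of "j < i"]
        pred_less_or_tie[OF snd[OF ij(2)] snd[OF ij(1)], of "j < i"]
      unfolding q before_def by (cases c) simp_all
  qed
  moreover have "perm (rel p) r = perm_of_points n p r" for p r
  proof (cases "r < n")
    case True
    have rel_iff: "(i, j, c) \<in> rel p \<longleftrightarrow> before i j c p" if "i < n" "j < n" for i j c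
      using that by (simp add: rel_def I_def)
    have rank: "rank (rel p) c i = card {j. j < n \<and> before i j c p}" if "i < n" for i c
      unfolding rank_def using rel_iff[OF that] by (intro arg_cong[where f = card] Collect_cong) blast
    have rank_fst: "rank (rel p) True i = rank_of n (\<lambda>i. fst (p i)) i" if "i < n" for i
      unfolding rank[OF that] by (simp only: rank_of_def before_def if_True)
    have rank_snd: "rank (rel p) False i = rank_of n (\<lambda>i. snd (p i)) i" if "i < n" for i
      unfolding rank[OF that] by (simp only: rank_of_def before_def if_False)
    have "r \<in> rank_of n (\<lambda>i. fst (p i)) ` {..<n}"
      using bij_betw_imp_surj_on[OF bij_betw_rank_of] True by simp
    then obtain i where i: "i < n" "r = rank_of n (\<lambda>i. fst (p i)) i" by blast
    have "(THE i. i < n \<and> rank (rel p) True i = r) = i"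
    proof (rule the_equality)
      fix k assume k: "k < n \<and> rank (rel p) True k = r"
      then have "rank_of n (\<lambda>i. fst (p i)) k = rank_of n (\<lambda>i. fst (p i)) i"
        using rank_fst[of k] i(2) by simp
      then show "k = i"
        using inj_onD[OF bij_betw_imp_inj_on[OF bij_betw_rank_of]] k i(1) by blast
    qed (use i rank_fst in simp)
    then have "perm (rel p) r = rank_of n (\<lambda>i. snd (p i)) i"
      using True rank_snd[OF i(1)] by (simp add: perm_def)
    then show ?thesis by (simp add: i(2) perm_of_points_rank[OF i(1)])
  qed (simp add: perm_of_points_def perm_def)
  then have "(\<lambda>p. perm (rel p)) = perm_of_points n" by (intro ext)
  ultimately show ?thesis by (simp only:)
qed

text \<open>Fubini: split off coordinate \<open>i\<close>. For each fixed value of it, coordinate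
  \<open>j\<close> almost surely avoids that single value.\<close>

lemma AE_sample_nth_neq:
  assumes "i < n" "j < n" "i \<noteq> j"
  shows "AE x in sample n. x i \<noteq> x j"
proof -
  let ?J = "{..<n} - {i}"
  let ?P = "\<Pi>\<^sub>M k\<in>?J. unif01"
  have ins: "insert i ?J = {..<n}" using assms by auto
  interpret P: prob_space ?P by (intro prob_space_PiM prob_space_unif01)
  interpret U: prob_space unif01 by (rule prob_space_unif01)
  interpret pair_sigma_finite unif01 ?P ..
  have upd: "(\<lambda>(t, X). X(i := t)) \<in> measurable (unif01 \<Otimes>\<^sub>M ?P) (sample n)"
    using measurable_fun_upd[of "{..<n}" ?J i "\<lambda>q. snd q" "unif01 \<Otimes>\<^sub>M ?P" "\<lambda>_. unif01" "\<lambda>q. fst q"] ins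
    by (simp add: case_prod_unfold)
  have "{x \<in> space (sample n). x i \<noteq> x j} \<in> sets (sample n)"
    using assms by (intro borel_measurable_neq measurable_from_unif01 sample_nth_measurable)
  note AE_upd = AE_distr_iff[OF upd this]
  have "(\<lambda>q. snd q j) \<in> borel_measurable (unif01 \<Otimes>\<^sub>M ?P)"
    by (rule measurable_from_unif01, rule measurable_compose[OF measurable_snd])
      (use assms in \<open>auto intro: measurable_component_singleton\<close>)
  moreover have "(\<lambda>q. fst q) \<in> borel_measurable (unif01 \<Otimes>\<^sub>M ?P)"
    by (rule measurable_from_unif01) simp
  ultimately have "{q \<in> space (unif01 \<Otimes>\<^sub>M ?P). fst q \<noteq> snd q j} \<in> sets (unif01 \<Otimes>\<^sub>M ?P)"
    by (intro borel_measurable_neq)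
  moreover have "AE t in unif01. AE X in ?P. fst (t, X) \<noteq> snd (t, X) j"
  proof (rule AE_I2)
    fix t :: real
    have "AE s in unif01. t \<noteq> s"
      using AE_unif01_notin_countable[of "{t}"] by (auto elim: AE_mp)
    then show "AE X in ?P. fst (t, X) \<noteq> snd (t, X) j"
      using assms prob_space_unif01 AE_PiM_component[of ?J "\<lambda>_. unif01" j "\<lambda>s. t \<noteq> s"] by simp
  qed
  ultimately have "AE q in unif01 \<Otimes>\<^sub>M ?P. fst q \<noteq> snd q j" by (rule AE_pair_measure)
  then have AE: "AE q in unif01 \<Otimes>\<^sub>M ?P. (case q of (t, X) \<Rightarrow> X(i := t)) i \<noteq> (case q of (t, X) \<Rightarrow> X(i := t)) j"
    using assms by (auto simp: case_prod_unfold)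
  have "AE x in distr (unif01 \<Otimes>\<^sub>M ?P) (sample n) (\<lambda>(t, X). X(i := t)). x i \<noteq> x j"
    by (subst AE_upd) (rule AE)
  also have "distr (unif01 \<Otimes>\<^sub>M ?P) (sample n) (\<lambda>(t, X). X(i := t)) = sample n"
    using distr_pair_PiM_eq_PiM[of ?J "\<lambda>_. unif01" i] prob_space_unif01 unfolding ins by simp
  finally show ?thesis .
qed

context part_weights
begin

text \<open>Inside a part \<open>reflect\<close> reverses the order. Across parts it preserves the
  order, since points below 1 stay in their own parts; the reflected parts are open on the left,
  which keeps the comparison strict.\<close>

lemma inversion_iff_same_colour:
  assumes x: "0 \<le> x" "x < 1" and y: "0 \<le> y" "y < 1" and "x \<noteq> y"
  shows "(x - y) * (reflect x - reflect y) < 0 \<longleftrightarrow> colour b x = colour b y" "reflect x \<noteq> reflect y"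
proof -
  have cross: "x < y \<and> reflect x < reflect y"
    if "0 \<le> x" "x < 1" "0 \<le> y" "y < 1" "colour b x < colour b y" for x y
  proof -
    have "cum b (Suc (colour b x)) \<le> cum b (colour b y)"
      using strict_mono_cum that(5) by (simp add: strict_mono_less_eq Suc_le_eq)
    then show ?thesis
      using colour_bounds[OF that(1,2)] colour_bounds[OF that(3,4)]
        reflect_bounds[OF that(1,2)] reflect_bounds[OF that(3,4)] by linarith
  qed
  consider "colour b x = colour b y" | "colour b x < colour b y" | "colour b y < colour b x" by linarith
  then have "((x - y) * (reflect x - reflect y) < 0 \<longleftrightarrow> colour b x = colour b y) \<and> reflect x \<noteq> reflect y"
  proof cases
    case 1
    then have "reflect x - reflect y = - (x - y)" using x y by (simp add: reflect_def)
    moreover have "0 < (x - y) * (x - y)" using \<open>x \<noteq> y\<close> by (simp add: zero_less_mult_iff) linarith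
    ultimately have "(x - y) * (reflect x - reflect y) < 0" by (simp only: mult_minus_right neg_less_0_iff_less)
    then show ?thesis using 1 by auto
  next
    case 2
    then show ?thesis using cross[OF x y] by (auto simp: mult_less_0_iff)
  next
    case 3
    then show ?thesis using cross[OF y x] by (auto simp: mult_less_0_iff)
  qed
  then show "(x - y) * (reflect x - reflect y) < 0 \<longleftrightarrow> colour b x = colour b y" "reflect x \<noteq> reflect y"
    by auto
qed

text \<open>A coupling: both random graphs are built from the same uniform sample and are almost
  surely isomorphic, because inversions are exactly the pairs of equal colour.\<close>

lemma associated_reflection_permuton:
  "measure (distr (random_perm n reflection_permuton) (count_space UNIV) (inversion_graph n)) {G. G \<cong>\<^sub>g H} =
   measure (W_random_graph n (same_colour_graphon b)) {G. G \<cong>\<^sub>g H}"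
proof -
  let ?g = "\<lambda>x. (x, reflect x)"
  let ?points = "compose {..<n} ?g"
  let ?M = "\<Pi>\<^sub>M i\<in>{..<n}. unif01 \<Otimes>\<^sub>M unif01"
  let ?inv = "\<lambda>x. inversion_graph n (perm_of_points n (?points x))"
  let ?col = "\<lambda>x. graph_of_rel n {(i, j). same_colour_graphon b (x i) (x j) = 1}"
  interpret sigma: prob_space unif01 by (rule prob_space_unif01)
  interpret UU: pair_prob_space unif01 unif01 ..
  have PiM: "(\<Pi>\<^sub>M i\<in>{..<n}. reflection_permuton) = distr (sample n) ?M ?points"
    unfolding reflection_permuton_def
    using measurable_graph_reflect prob_space_unif01 UU.prob_space_axioms
    by (intro distr_PiM_finite_prob_space'[symmetric]) auto
  have points: "?points \<in> measurable (sample n) ?M"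
    unfolding compose_def
    by (intro measurable_restrict measurable_compose[OF sample_nth_measurable measurable_graph_reflect]) simp
  have inv: "?inv \<in> measurable (sample n) (count_space UNIV)"
    using measurable_compose[OF measurable_compose[OF points measurable_perm_of_points],
        of "inversion_graph n" "count_space UNIV"] by simp
  have "distr (random_perm n reflection_permuton) (count_space UNIV) (inversion_graph n) =
      distr (sample n) (count_space UNIV) ?inv"
    unfolding random_perm_def PiM
    by (simp add: distr_distr[OF measurable_perm_of_points points]
        distr_distr[OF _ measurable_compose[OF points measurable_perm_of_points]] comp_def)
  then have "measure (distr (random_perm n reflection_permuton) (count_space UNIV) (inversion_graph n)) {G. G \<cong>\<^sub>g H} =
      measure (sample n) {x \<in> space (sample n). ?inv x \<cong>\<^sub>g H}"
    using inv by (simp add: measure_distr vimage_def Int_def conj_commute)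
  also have "\<dots> = measure (sample n) {x \<in> space (sample n). ?col x \<cong>\<^sub>g H}"
  proof (rule measure_eq_AE)
    \<comment> \<open>Two almost sure events make the comparison valid: no ties, and no coordinate
      equal to 1, where colour and reflection are artificial.\<close>
    have "AE x in sample n. \<forall>i\<in>{..<n}. \<forall>j\<in>{..<n}. i \<noteq> j \<longrightarrow> x i \<noteq> x j"
      by (intro AE_finite_allI) (auto intro: AE_sample_nth_neq)
    moreover have "AE x in sample n. \<forall>i\<in>{..<n}. x i \<notin> {1}"
      using prob_space_unif01 AE_unif01_notin_countable[of "{1}"]
      by (intro AE_finite_allI AE_PiM_component) auto
    ultimately show "AE x in sample n. x \<in> {x \<in> space (sample n). ?inv x \<cong>\<^sub>g H} \<longleftrightarrow>
        x \<in> {x \<in> space (sample n). ?col x \<cong>\<^sub>g H}"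
    proof eventually_elim
      case (elim x)
      have "?inv x \<cong>\<^sub>g H \<longleftrightarrow> ?col x \<cong>\<^sub>g H" if "x \<in> space (sample n)"
      proof -
        have x: "0 \<le> x i" "x i < 1" if "i < n" for i
          using \<open>x \<in> space (sample n)\<close> elim(2) that by (fastforce simp: space_PiM PiE_iff order_le_less)+
        have points_nth: "?points x i = (x i, reflect (x i))" if "i < n" for i
          using that by (simp add: compose_def)
        have neq: "x i \<noteq> x j" if "i < n" "j < n" "i \<noteq> j" for i j using elim(1) that by auto
        let ?R = "{(i, j). (fst (?points x i) - fst (?points x j)) *
            (snd (?points x i) - snd (?points x j)) < 0}"
        have col: "?col x = graph_of_rel n ?R"
          by (intro graph_of_rel_cong)
            (simp add: points_nth same_colour_graphon_def inversion_iff_same_colour x neq)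
        have "graph_of_rel n ?R \<cong>\<^sub>g ?inv x"
          by (intro inversion_graph_of_points inj_onI; rule ccontr)
            (auto simp: points_nth neq inversion_iff_same_colour x)
        then have "?col x \<cong>\<^sub>g ?inv x" by (simp only: col)
        then show ?thesis by (rule graph_iso_cong_left[symmetric])
      qed
      then show ?case by blast
    qed
    show "{x \<in> space (sample n). ?inv x \<cong>\<^sub>g H} \<in> sets (sample n)"
      using measurable_sets[OF inv, of "{G. G \<cong>\<^sub>g H}"] by (simp add: vimage_def Int_def conj_commute)
    have "?col \<in> measurable (sample n) (count_space UNIV)"
      by (intro measurable_graph_of_rel pred_W_eq_1 measurable_same_colour_graphon) auto
    from measurable_sets[OF this, of "{G. G \<cong>\<^sub>g H}"]
    show "{x \<in> space (sample n). ?col x \<cong>\<^sub>g H} \<in> sets (sample n)"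
      by (simp add: vimage_def Int_def conj_commute)
  qed
  also have "\<dots> = measure (W_random_graph n (same_colour_graphon b)) {G. G \<cong>\<^sub>g H}"
  proof -
    have "?col \<in> measurable (sample n) (count_space UNIV)"
      by (intro measurable_graph_of_rel pred_W_eq_1 measurable_same_colour_graphon) auto
    moreover have "W_random_graph n (same_colour_graphon b) = distr (sample n) (count_space UNIV) ?col"
      by (intro W_random_graph_zero_one measurable_same_colour_graphon) (simp add: same_colour_graphon_def)
    ultimately show ?thesis by (simp add: measure_distr vimage_def Int_def conj_commute)
  qed
  finally show ?thesis .
qed

end

section \<open>The geometric clique graphon\<close>

text \<open>The sequence \<open>part_size\<close> with its index shifted to start at 0.\<close>

definition geometric_weights :: "real \<Rightarrow> nat \<Rightarrow> real" where
  "geometric_weights \<alpha> i = (1 - \<alpha>) * \<alpha> ^ i"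

lemma part_weights_geometric:
  assumes "0 < \<alpha>" "\<alpha> < 1"
  shows "part_weights (geometric_weights \<alpha>)"
proof
  show "0 < geometric_weights \<alpha> i" for i using assms by (simp add: geometric_weights_def)
  have "(\<lambda>i. (1 - \<alpha>) * \<alpha> ^ i) sums ((1 - \<alpha>) * (1 / (1 - \<alpha>)))"
    using assms by (intro sums_mult geometric_sums) simp
  then show "geometric_weights \<alpha> sums 1"
    using assms by (simp add: geometric_weights_def[abs_def])
qed

lemma cum_geometric: "cum (geometric_weights \<alpha>) i = 1 - \<alpha> ^ i"
  unfolding cum_def by (induction i) (simp_all add: geometric_weights_def algebra_simps)

lemma clique_graphon_eq:
  "clique_graphon \<alpha> x y = of_bool (\<exists>i. x \<in> {cum (geometric_weights \<alpha>) i..cum (geometric_weights \<alpha>) (Suc i)} \<and>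
    y \<in> {cum (geometric_weights \<alpha>) i..cum (geometric_weights \<alpha>) (Suc i)})"
proof -
  have sum: "(\<Sum>i=1..j. part_size \<alpha> i) = cum (geometric_weights \<alpha>) j" for j
    unfolding cum_def One_nat_def sum.atLeast1_atMost_eq by (simp add: part_size_def geometric_weights_def)
  have shift: "(\<exists>j\<ge>1. P j) \<longleftrightarrow> (\<exists>i. P (Suc i))" for P
    by (metis One_nat_def Suc_le_D Suc_le_mono le0)
  show ?thesis unfolding clique_graphon_def sum shift of_bool_def by simp
qed

context
  fixes \<alpha> :: real
  assumes \<alpha>: "0 < \<alpha>" "\<alpha> < 1"
begin

interpretation part_weights "geometric_weights \<alpha>"
  by (rule part_weights_geometric[OF \<alpha>])

lemma measurable_clique_graphon:
  "case_prod (clique_graphon \<alpha>) \<in> borel_measurable (unif01 \<Otimes>\<^sub>M unif01)"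
proof -
  have [measurable]: "fst \<in> borel_measurable (unif01 \<Otimes>\<^sub>M unif01)" "snd \<in> borel_measurable (unif01 \<Otimes>\<^sub>M unif01)"
    by (simp_all add: measurable_from_unif01)
  show ?thesis
    unfolding case_prod_unfold clique_graphon_eq of_bool_def atLeastAtMost_iff by measurable
qed

lemma graphon_clique_graphon: "graphon (clique_graphon \<alpha>)"
  using measurable_clique_graphon unfolding graphon_def clique_graphon_eq by auto

text \<open>Closed and half-open parts differ only at breakpoints. The point 1 is excluded too: it
  lies in no closed part, so it is not even adjacent to itself, whereas it has a colour. These
  exceptions are countable.\<close>

lemma W_random_graph_clique_graphon:
  "W_random_graph n (clique_graphon \<alpha>) = W_random_graph n (same_colour_graphon (geometric_weights \<alpha>))"
proof -
  let ?b = "geometric_weights \<alpha>"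
  obtain p where p: "\<And>i. pmf p i = ?b i" using ex_part_pmf by blast
  let ?N = "insert 1 (range (cum ?b))"
  have "W_random_graph n (clique_graphon \<alpha>) =
    measure_pmf (map_pmf (\<lambda>c. graph_of_rel n (kernel_on n c)) (Pi_pmf {..<n} undefined (\<lambda>_. p)))"
  proof (rule W_random_graph_colour_classes)
    show "AE x in unif01. x \<notin> ?N" by (intro AE_unif01_notin_countable) simp
    fix x y assume "x \<in> {0..1} - ?N" "y \<in> {0..1} - ?N"
    then have x: "0 \<le> x" "x < 1" "\<And>i. x \<noteq> cum ?b i" and y: "0 \<le> y" "y < 1" "\<And>i. y \<noteq> cum ?b i"
      by (auto simp: order_le_less)
    have part_iff: "t \<in> {cum ?b i..cum ?b (Suc i)} \<longleftrightarrow> colour ?b t = i"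
      if "0 \<le> t" "t < 1" "\<And>i. t \<noteq> cum ?b i" for t i
    proof -
      have "t \<le> cum ?b (Suc i) \<longleftrightarrow> t < cum ?b (Suc i)" using that(3)[of "Suc i"] by (simp add: order_le_less)
      then show ?thesis unfolding colour_eq_iff[OF that(1,2)] by simp
    qed
    show "clique_graphon \<alpha> x y = 1 \<longleftrightarrow> colour ?b x = colour ?b y"
      unfolding clique_graphon_eq part_iff[OF x] part_iff[OF y] by auto
  qed (use measurable_clique_graphon measurable_colour_unif01 measure_colour p in
      \<open>auto simp: clique_graphon_eq\<close>)
  then show ?thesis by (simp add: W_random_graph_same_colour[OF p])
qed

lemma geometric_permuton_eq: "geometric_permuton \<alpha> = reflection_permuton"
  unfolding geometric_permuton_def reflection_permuton_eq cum_geometric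
  by (simp add: geometric_weights_def)

lemma permuton_geometric: "permuton (geometric_permuton \<alpha>)"
  unfolding geometric_permuton_eq by (rule permuton_reflection_permuton)

lemma associated_clique_graphon: "associated_graphon (geometric_permuton \<alpha>) (clique_graphon \<alpha>)"
  unfolding associated_graphon_def geometric_permuton_eq
  by (simp add: graphon_clique_graphon W_random_graph_clique_graphon associated_reflection_permuton)

end

section \<open>Densities as functions of power sums\<close>

lemma density_of_same_colour:
  assumes "part_weights b" "\<And>i. pmf p i = b i"
  shows "density_of H (same_colour_graphon b) =
    measure_pmf.prob (map_pmf (kernel_on (card (verts H))) (Pi_pmf {..<card (verts H)} undefined (\<lambda>_. p)))
      {R. graph_of_rel (card (verts H)) R \<cong>\<^sub>g H}"
  unfolding density_of_def part_weights.W_random_graph_same_colour[OF assms] by (simp add: vimage_def)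

lemma density_of_same_colour_cong:
  assumes b: "part_weights b" and b': "part_weights b'"
    and sums: "\<And>k. 1 \<le> k \<Longrightarrow> k \<le> card (verts H) \<Longrightarrow> (\<Sum>i. b i ^ k) = (\<Sum>i. b' i ^ k)"
  shows "density_of H (same_colour_graphon b) = density_of H (same_colour_graphon b')"
proof -
  obtain p where p: "\<And>i. pmf p i = b i" using part_weights.ex_part_pmf[OF b] by blast
  obtain p' where p': "\<And>i. pmf p' i = b' i" using part_weights.ex_part_pmf[OF b'] by blast
  show ?thesis
    unfolding density_of_same_colour[OF b p] density_of_same_colour[OF b' p']
    by (subst map_kernel_on_cong[of _ p p']) (simp_all add: p p' sums)
qed

text \<open>A bijection sends distinct vertices to distinct vertices, all of which are adjacent in
  the complete graph; the diagonal belongs to the kernel anyway.\<close>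

lemma graph_iso_complete_iff:
  "graph_of_rel n (kernel_on n c) \<cong>\<^sub>g graph_of_rel n UNIV \<longleftrightarrow> kernel_on n c = {..<n} \<times> {..<n}"
proof
  assume "graph_of_rel n (kernel_on n c) \<cong>\<^sub>g graph_of_rel n UNIV"
  then obtain f where f: "bij_betw f {..<n} {..<n}"
    "\<And>u v. u < n \<Longrightarrow> v < n \<Longrightarrow> {u, v} \<in> edges (graph_of_rel n (kernel_on n c)) \<longleftrightarrow>
      {f u, f v} \<in> edges (graph_of_rel n UNIV)"
    unfolding graph_iso_def by auto
  have less: "(u, v) \<in> kernel_on n c" if "u < v" "v < n" for u v
  proof -
    have "f u < n" "f v < n" using bij_betw_apply[OF f(1)] that by auto
    moreover have "f u \<noteq> f v" using f(1) that by (auto simp: bij_betw_def inj_on_def)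
    then have "f u < f v \<or> f v < f u" by linarith
    ultimately have "{f u, f v} \<in> edges (graph_of_rel n UNIV)"
      using edge_graph_of_rel[of "f u" "f v" n UNIV] edge_graph_of_rel[of "f v" "f u" n UNIV]
      by (auto simp: insert_commute)
    then show ?thesis using f(2)[of u v] edge_graph_of_rel that by simp
  qed
  have "(u, v) \<in> kernel_on n c" if "u < n" "v < n" for u v
    using less[of u v] less[of v u] that by (cases u v rule: linorder_cases) (auto simp: kernel_on_def)
  then show "kernel_on n c = {..<n} \<times> {..<n}" by (auto simp: kernel_on_def)
next
  assume "kernel_on n c = {..<n} \<times> {..<n}"
  then have "graph_of_rel n (kernel_on n c) = graph_of_rel n UNIV"
    by (intro graph_of_rel_cong) auto
  then show "graph_of_rel n (kernel_on n c) \<cong>\<^sub>g graph_of_rel n UNIV"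
    by (simp add: graph_iso_refl)
qed

lemma density_of_complete_graph:
  assumes b: "part_weights b" and "1 \<le> n"
  shows "density_of (graph_of_rel n UNIV) (same_colour_graphon b) = (\<Sum>i. b i ^ n)"
proof -
  obtain p where p: "\<And>i. pmf p i = b i" using part_weights.ex_part_pmf[OF b] by blast
  show ?thesis
    using prob_kernel_on_full[OF assms(2), of undefined p]
    by (simp add: density_of_same_colour[OF b p] vimage_def graph_iso_complete_iff p)
qed

text \<open>\<open>W\<close> enters only through its random graphs, so the result reaches the clique
  graphon with its closed parts, while the competitor is built with half-open ones.\<close>

lemma not_finitely_forcible_same_colour:
  fixes W :: "real \<Rightarrow> real \<Rightarrow> real"
  assumes b: "part_weights b" and dec: "\<And>i. b (Suc i) < b i"
    and W: "\<And>n. W_random_graph n W = W_random_graph n (same_colour_graphon b)"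
  shows "\<not> finitely_forcible W"
proof
  assume "finitely_forcible W"
  then obtain \<H> where \<H>: "finite \<H>" and forcing:
    "\<And>W'. graphon W' \<Longrightarrow> (\<And>H. H \<in> \<H> \<Longrightarrow> density_of H W' = density_of H W) \<Longrightarrow> weakly_isomorphic W' W"
    unfolding finitely_forcible_def by blast
  interpret b: part_weights b by (rule b)
  have density_W: "density_of H W = density_of H (same_colour_graphon b)" for H
    by (simp add: density_of_def W)
  \<comment> \<open>\<open>insert 0\<close> gives the maximum a meaning for an empty family. Adding
    2 makes \<open>N\<close> exceed every order in the family and also 1, so that the first power
    sum is among those preserved.\<close>
  define N where "N = Max (insert 0 (card ` verts ` \<H>)) + 2"
  have small: "card (verts H) < N" if "H \<in> \<H>" for H
  proof -
    have "card (verts H) \<le> Max (insert 0 (card ` verts ` \<H>))"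
      using \<H> that by (intro Max_ge) auto
    then show ?thesis by (simp add: N_def)
  qed
  have N: "1 < N" by (simp add: N_def)
  obtain r where r: "\<And>i. i < N \<Longrightarrow> 0 < r i"
    "\<And>k. 1 \<le> k \<Longrightarrow> k < N \<Longrightarrow> (\<Sum>i<N. r i ^ k) = (\<Sum>i<N. b i ^ k)"
    "(\<Sum>i<N. r i ^ N) \<noteq> (\<Sum>i<N. b i ^ N)"
    using ex_power_sums_agree_below[of N b] N dec b.pos by (metis less_imp_le)
  \<comment> \<open>The tail is untouched, so the two families of sizes differ in finitely many
    entries and their infinite power sums differ by a finite sum.\<close>
  define b' where "b' i = (if i < N then r i else b i)" for i
  have le_1: "b i \<le> 1" for i
    using sum_le_suminf[of b "{i}"] b.sums b.pos by (simp add: sums_iff less_imp_le)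
  have summable: "summable (\<lambda>i. b i ^ k)" if "1 \<le> k" for k
  proof (rule summable_comparison_test')
    show "summable b" using b.sums by (simp add: sums_iff)
    show "norm (b i ^ k) \<le> b i" if "0 \<le> i" for i
      using power_decreasing[of 1 k "b i"] \<open>1 \<le> k\<close> le_1[of i] b.pos[of i] by (simp add: less_imp_le)
  qed
  have sums': "(\<lambda>i. b' i ^ k) sums ((\<Sum>i. b i ^ k) + ((\<Sum>i<N. r i ^ k) - (\<Sum>i<N. b i ^ k)))"
    if "1 \<le> k" for k
  proof -
    have "(\<lambda>i. b' i ^ k - b i ^ k) sums (\<Sum>i<N. b' i ^ k - b i ^ k)"
      by (rule sums_finite) (auto simp: b'_def)
    from sums_add[OF summable_sums[OF summable[OF that]] this] show ?thesis
      by (simp add: sum_subtractf b'_def)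
  qed
  have b': "part_weights b'"
  proof
    show "0 < b' i" for i using r(1) b.pos by (simp add: b'_def)
    \<comment> \<open>The case \<open>k = 1\<close> of the preserved power sums: the new sizes still
      fill the unit interval.\<close>
    show "b' sums 1" using sums'[of 1] r(2)[of 1] N b.sums by (simp add: sums_iff)
  qed
  have "weakly_isomorphic (same_colour_graphon b') W"
  proof (rule forcing)
    show "graphon (same_colour_graphon b')" using b' by (rule part_weights.graphon_same_colour)
    fix H assume "H \<in> \<H>"
    then show "density_of H (same_colour_graphon b') = density_of H W"
      unfolding density_W using small[of H] sums' r(2)
      by (intro density_of_same_colour_cong b b') (simp add: sums_iff)
  qed
  then have "density_of (graph_of_rel N UNIV) (same_colour_graphon b') =
      density_of (graph_of_rel N UNIV) (same_colour_graphon b)"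
    by (simp add: weakly_isomorphic_def density_W finite_simple_graph_of_rel)
  then have "(\<Sum>i. b' i ^ N) = (\<Sum>i. b i ^ N)"
    using N by (simp add: density_of_complete_graph b b')
  then show False using sums'[of N] r(3) N by (simp add: sums_iff)
qed

theorem theorem12:
  fixes \<alpha> :: real
  assumes "0 < \<alpha>" and "\<alpha> < 1"
  shows "graphon (clique_graphon \<alpha>) \<and>
         permuton (geometric_permuton \<alpha>) \<and>
         (\<exists>W. associated_graphon (geometric_permuton \<alpha>) W) \<and>
         (\<forall>W. associated_graphon (geometric_permuton \<alpha>) W
              \<longrightarrow> weakly_isomorphic (clique_graphon \<alpha>) W) \<and>
         \<not> finitely_forcible (clique_graphon \<alpha>)"
proof (intro conjI allI impI)
  show "graphon (clique_graphon \<alpha>)" by (rule graphon_clique_graphon[OF assms])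
  show "permuton (geometric_permuton \<alpha>)" by (rule permuton_geometric[OF assms])
  note associated = associated_clique_graphon[OF assms]
  then show "\<exists>W. associated_graphon (geometric_permuton \<alpha>) W" by blast
  \<comment> \<open>All graphons associated with one permuton have the densities of its inversion
    graphs, taken at the order of \<open>H\<close>, and the clique graphon is one of them.\<close>
  show "weakly_isomorphic (clique_graphon \<alpha>) W" if "associated_graphon (geometric_permuton \<alpha>) W" for W
    using that associated unfolding associated_graphon_def weakly_isomorphic_def density_of_def by simp
  show "\<not> finitely_forcible (clique_graphon \<alpha>)"
  proof (rule not_finitely_forcible_same_colour)
    show "part_weights (geometric_weights \<alpha>)" by (rule part_weights_geometric[OF assms])
    show "geometric_weights \<alpha> (Suc i) < geometric_weights \<alpha> i" for i
      using assms by (simp add: geometric_weights_def mult_less_cancel_right2 not_le)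
    show "W_random_graph n (clique_graphon \<alpha>) = W_random_graph n (same_colour_graphon (geometric_weights \<alpha>))" for n
      by (rule W_random_graph_clique_graphon[OF assms])
  qed
qed

end
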